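(* Consider the sequence of scaled single-resource loss models indexed by $n\ge1$ described in the context, with base data $b$, $(\lambda_i,\mu_i,b_i,r_i)_{i=1}^m$, $\rho_i=\lambda_i/\mu_i$. Let $\alpha^*$ be an optimal solution of $$\max_\alpha\ \sum_{i=1}^m r_i\rho_i\alpha_i\quad\text{s.t.}\quad\sum_{i=1}^m b_i\rho_i\alpha_i\le b,\quad0\le\alpha_i\le1,$$ and for $\varepsilon\ge 0$ let $\alpha^\varepsilon$ be an optimal solution of the same program with $b$ replaced by $b/(1+4\varepsilon)$. Let $(u^*,\mathbf v^* )$ be an optimal solution of the dual program $\min\{ub+\sum_iv_i:\ v_i+b_i\rho_iu\ge r_i\rho_i\ \forall i,\ \mathbf v\ge\mathbf 0,\ u\ge0\}$ and let $\varepsilon_0$ be the largest $\varepsilon$ for which $(u^*,\mathbf v^* )$ is also optimal for this dual program with $b$ replaced by $b/(1+4\varepsilon)$. Suppose $0<\varepsilon<\min\{\varepsilon_0,\frac14\}$, $$c_i^0=(1+4\varepsilon)\alpha_i^\varepsilon b_i\rho_i,\qquad c_i^1=(1+4\varepsilon)(1-\alpha_i^\varepsilon)b_i\rho_i,\qquad \beta=\frac2\varepsilon\log\Big(\frac2\varepsilon\Big)+4,$$ and the initial load of the fictitious system in the $n$th model is $\bar y_i^{(n)}(0^-)=(1-\alpha_i^\varepsilon)\rho_i^{(n)}$, $i=1,\dots,m$. Let $\bar R^{(n)}(t)$ be the reward rate at time $t$ of the penalty policy $\bar\pi$ in the $n$th system. Then for each $t\ge 0$ the limit $\bar R^{(\infty)}(t)=\lim_{n\to\infty}\bar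 R^{(n)}(t)$ exists almost surely and is nonrandom. Moreover, $$\bar R^{(\infty)}(t)\ge\sum_{i=1}^m r_i\rho_i\alpha_i^*(1-e^{-\mu_it})-\mathcal O(\varepsilon),$$ where $\mathcal O(\varepsilon)$ denotes a quantity bounded by $C\varepsilon$ with $C$ independent of $\varepsilon$.
   Context: Single-resource loss model: a resource of capacity $b$; $m$ independent Poisson arrival classes with rates $\lambda_i$; class $i$ requests need capacity $b_i$, have independent $\exp(\mu_i)$ service times and pay $r_i\ge0$ per unit time in service; each arriving request is immediately accepted or rejected; the resource is initially empty. Standing assumption: classes with $\alpha_i^*=0$ have been dropped, so $\alpha_i^*>0$ for all $i$. Halfin–Whitt scaling. The $n$th system has $b^{(n)}=b$, $\lambda_i^{(n)}=n\lambda_i$, $\mu_i^{(n)}=\mu_i$, $b_i^{(n)}=b_i/n$, $r_i^{(n)}=r_i/n$; hence $\rho_i^{(n)}=n\rho_i$, and $c_i^0,c_i^1,\alpha^*,\alpha^\varepsilon$ do not depend on $n$. Penalty policy $\bar\pi$ in the $n$th system. Besides the original system there is a fictitious infinite-capacity system holding rejected requests. The state is $\bar{\mathbf s}^{(n)}=(\bar{\mathbf x}^{(n)},\bar{\mathbf y}^{(n)})$, the numbers of requests of each class in the original and fictitious systems, with $\bar{\mathbf x}^{(n)}(0^-)=\mathbf 0$ and $\bar{\mathbf y}^{(n)}(0^-)$ a prescribed initial load, whose requests have independent $\exp(\mu_i)$ service times. Let $\Psi_i(x_i,y_i)=\exp(\beta b_ix_i/c_i^0)+\exp(\beta b_iy_i/c_i^1)$.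 A class $i$ arrival finding normalized state $(\mathbf x,\mathbf y)=\frac1n\bar{\mathbf s}^{(n)}$ is accepted if $\frac{\partial\Psi_i}{\partial x_i}(x_i,y_i)\le\frac{\partial\Psi_i}{\partial y_i}(x_i,y_i)$ and $\sum_jb_jx_j+\frac1nb_i\le b$; otherwise it is rejected, i.e. sent to the fictitious system with an independent $\exp(\mu_i)$ service time. When $c_i^1=0$ (i.e. $\alpha_i^\varepsilon=1$) the derivative condition is regarded as always satisfied. All systems are built on a common probability space from independent rate-1 Poisson processes $A_i^x,A_i^y,D_i^x,D_i^y$, $i=1,\dots,m$, via $$\bar x_i^{(n)}(t)=\bar x_i^{(n)}(0^-)+A_i^x\Big(\int_0^t\nu_{x,i}^{(n)}\big(\tfrac1n\bar{\mathbf s}^{(n)}(s)\big)ds\Big)-D_i^x\Big(\int_0^t\kappa_{x,i}^{(n)}\big(\tfrac1n\bar{\mathbf s}^{(n)}(s)\big)ds\Big),$$ and similarly for $\bar y_i^{(n)}$ with $A_i^y,D_i^y,\nu_{y,i}^{(n)},\kappa_{y,i}^{(n)}$, where $\kappa_{x,i}^{(n)}(\mathbf x,\mathbf y)=n\mu_ix_i$, $\kappa_{y,i}^{(n)}(\mathbf x,\mathbf y)=n\mu_iy_i$, $\nu_{x,i}^{(n)}(\mathbf x,\mathbf y)=n\lambda_i$ if a class $i$ arrival finding normalized state $(\mathbf x,\mathbf y)$ is accepted and $0$ otherwise, and $\nu_{y,i}^{(n)}=n\lambda_i-\nu_{x,i}^{(n)}$. The reward rate is $\bar R^{(n)}(t)=\sum_{i=1}^mr_i^{(n)}\bar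 x_i^{(n)}(t)$.
   Formalization: Added: if optimal solutions differ in transient reward, α^ε ≤ α* componentwise (for arbitrary tie-breaking the bound is false). The initial fictitious load is rounded to an integer, either way; if α_i^ε = 0, where c_i^0 = 0 makes the policy undefined, class i is rejected. *)

theory Defs
  imports "HOL-Probability.Probability"
begin

section \<open>The loss model and its scaling\<close>

text \<open>The request classes are the elements of a finite type.\<close>

record 'i loss_model =
  cap :: real
  arr :: "'i \<Rightarrow> real"
  srv :: "'i \<Rightarrow> real"
  req :: "'i \<Rightarrow> real"
  rew :: "'i \<Rightarrow> real"

definition valid_model :: "('i::finite) loss_model \<Rightarrow> bool" where
  "valid_model L \<longleftrightarrow> cap L > 0 \<and>
     (\<forall>i. arr L i > 0 \<and> srv L i > 0 \<and> req L i > 0 \<and> rew L i \<ge> 0)"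

definition load :: "'i loss_model \<Rightarrow> 'i \<Rightarrow> real" where
  "load L i = arr L i / srv L i"

definition scaled :: "nat \<Rightarrow> 'i loss_model \<Rightarrow> 'i loss_model" where
  "scaled n L = L\<lparr>arr := (\<lambda>i. real n * arr L i),
                    req := (\<lambda>i. req L i / real n),
                    rew := (\<lambda>i. rew L i / real n)\<rparr>"

section \<open>The linear program and its dual\<close>

definition primal_feasible :: "('i::finite) loss_model \<Rightarrow> ('i \<Rightarrow> real) \<Rightarrow> bool" where
  "primal_feasible L \<alpha> \<longleftrightarrow>
     (\<Sum>i\<in>UNIV. req L i * load L i * \<alpha> i) \<le> cap L \<and> (\<forall>i. 0 \<le> \<alpha> i \<and> \<alpha> i \<le> 1)"

definition primal_value :: "('i::finite) loss_model \<Rightarrow> ('i \<Rightarrow> real) \<Rightarrow> real" where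
  "primal_value L \<alpha> = (\<Sum>i\<in>UNIV. rew L i * load L i * \<alpha> i)"

definition primal_optimal :: "('i::finite) loss_model \<Rightarrow> ('i \<Rightarrow> real) \<Rightarrow> bool" where
  "primal_optimal L \<alpha> \<longleftrightarrow> primal_feasible L \<alpha> \<and>
     (\<forall>\<alpha>'. primal_feasible L \<alpha>' \<longrightarrow> primal_value L \<alpha>' \<le> primal_value L \<alpha>)"

definition dual_feasible :: "('i::finite) loss_model \<Rightarrow> real \<Rightarrow> ('i \<Rightarrow> real) \<Rightarrow> bool" where
  "dual_feasible L u v \<longleftrightarrow> u \<ge> 0 \<and>
     (\<forall>i. v i \<ge> 0 \<and> v i + req L i * load L i * u \<ge> rew L i * load L i)"

definition dual_value :: "('i::finite) loss_model \<Rightarrow> real \<Rightarrow> ('i \<Rightarrow> real) \<Rightarrow> real" where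
  "dual_value L u v = u * cap L + (\<Sum>i\<in>UNIV. v i)"

definition dual_optimal :: "('i::finite) loss_model \<Rightarrow> real \<Rightarrow> ('i \<Rightarrow> real) \<Rightarrow> bool" where
  "dual_optimal L u v \<longleftrightarrow> dual_feasible L u v \<and>
     (\<forall>u' v'. dual_feasible L u' v' \<longrightarrow> dual_value L u v \<le> dual_value L u' v')"

definition shrunk :: "real \<Rightarrow> 'i loss_model \<Rightarrow> 'i loss_model" where
  "shrunk \<epsilon> L = L\<lparr>cap := cap L / (1 + 4 * \<epsilon>)\<rparr>"

text \<open>The largest perturbation under which \<open>(u, v)\<close> stays dual optimal. Extended-real valued,
  because every perturbation may be admissible (e.g. when all rewards vanish).\<close>

definition eps0 :: "('i::finite) loss_model \<Rightarrow> real \<Rightarrow> ('i \<Rightarrow> real) \<Rightarrow> ereal" where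
  "eps0 L u v = Sup (ereal ` {\<epsilon>. \<epsilon> \<ge> 0 \<and> dual_optimal (shrunk \<epsilon> L) u v})"

definition transient_reward :: "('i::finite) loss_model \<Rightarrow> ('i \<Rightarrow> real) \<Rightarrow> real \<Rightarrow> real" where
  "transient_reward L \<alpha> t =
     (\<Sum>i\<in>UNIV. rew L i * load L i * \<alpha> i * (1 - exp (- srv L i * t)))"

text \<open>Classes with equal reward per unit of capacity make the optimal solutions non-unique, and
  two optimal solutions can have different transient rewards if the service rates differ; an
  optimal \<open>\<alpha>e\<close> of the shrunk program that breaks such ties differently from \<open>\<alpha>s\<close> would then be
  far from \<open>\<alpha>s\<close> however small the perturbation is. The second alternative excludes this; it is
  needed only when the transient reward depends on the choice of the optimal solution (so never
  when the optimal solution is unique).\<close>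

definition consistent_choice ::
    "('i::finite) loss_model \<Rightarrow> ('i \<Rightarrow> real) \<Rightarrow> ('i \<Rightarrow> real) \<Rightarrow> bool" where
  "consistent_choice L \<alpha>s \<alpha>e \<longleftrightarrow>
     (\<forall>\<alpha>. primal_optimal L \<alpha> \<longrightarrow>
        (\<forall>t\<ge>0. transient_reward L \<alpha> t = transient_reward L \<alpha>s t)) \<or>
     (\<forall>i. \<alpha>e i \<le> \<alpha>s i)"

section \<open>The penalty policy\<close>

definition pen_c0 :: "'i loss_model \<Rightarrow> real \<Rightarrow> ('i \<Rightarrow> real) \<Rightarrow> 'i \<Rightarrow> real" where
  "pen_c0 L \<epsilon> \<alpha> i = (1 + 4 * \<epsilon>) * \<alpha> i * req L i * load L i"

definition pen_c1 :: "'i loss_model \<Rightarrow> real \<Rightarrow> ('i \<Rightarrow> real) \<Rightarrow> 'i \<Rightarrow> real" where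
  "pen_c1 L \<epsilon> \<alpha> i = (1 + 4 * \<epsilon>) * (1 - \<alpha> i) * req L i * load L i"

definition pen_beta :: "real \<Rightarrow> real" where
  "pen_beta \<epsilon> = 2 / \<epsilon> * ln (2 / \<epsilon>) + 4"

definition Psi :: "'i loss_model \<Rightarrow> real \<Rightarrow> ('i \<Rightarrow> real) \<Rightarrow> 'i \<Rightarrow> real \<Rightarrow> real \<Rightarrow> real" where
  "Psi L \<epsilon> \<alpha> i x y =
     exp (pen_beta \<epsilon> * req L i * x / pen_c0 L \<epsilon> \<alpha> i) +
     exp (pen_beta \<epsilon> * req L i * y / pen_c1 L \<epsilon> \<alpha> i)"

text \<open>If \<open>pen_c1 = 0\<close> the derivative condition counts as satisfied. If \<open>pen_c0 = 0\<close> (possible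
  only in degenerate programs) it counts as violated: the derivative in \<open>x\<close> tends to infinity as
  \<open>pen_c0\<close> decreases to zero, whereas division by zero would make it vanish here.\<close>

definition accepts ::
    "('i::finite) loss_model \<Rightarrow> real \<Rightarrow> ('i \<Rightarrow> real) \<Rightarrow> nat \<Rightarrow> 'i \<Rightarrow>
     ('i \<Rightarrow> real) \<Rightarrow> ('i \<Rightarrow> real) \<Rightarrow> bool" where
  "accepts L \<epsilon> \<alpha> n i x y \<longleftrightarrow>
     (pen_c1 L \<epsilon> \<alpha> i = 0 \<or>
      (pen_c0 L \<epsilon> \<alpha> i \<noteq> 0 \<and>
       deriv (\<lambda>z. Psi L \<epsilon> \<alpha> i z (y i)) (x i) \<le> deriv (\<lambda>z. Psi L \<epsilon> \<alpha> i (x i) z) (y i))) \<and>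
     (\<Sum>j\<in>UNIV. req L j * x j) + req L i / real n \<le> cap L"

definition nu_x ::
    "('i::finite) loss_model \<Rightarrow> real \<Rightarrow> ('i \<Rightarrow> real) \<Rightarrow> nat \<Rightarrow> 'i \<Rightarrow>
     ('i \<Rightarrow> real) \<Rightarrow> ('i \<Rightarrow> real) \<Rightarrow> real" where
  "nu_x L \<epsilon> \<alpha> n i x y = (if accepts L \<epsilon> \<alpha> n i x y then real n * arr L i else 0)"

definition nu_y ::
    "('i::finite) loss_model \<Rightarrow> real \<Rightarrow> ('i \<Rightarrow> real) \<Rightarrow> nat \<Rightarrow> 'i \<Rightarrow>
     ('i \<Rightarrow> real) \<Rightarrow> ('i \<Rightarrow> real) \<Rightarrow> real" where
  "nu_y L \<epsilon> \<alpha> n i x y = real n * arr L i - nu_x L \<epsilon> \<alpha> n i x y"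

definition kappa :: "'i loss_model \<Rightarrow> nat \<Rightarrow> 'i \<Rightarrow> ('i \<Rightarrow> real) \<Rightarrow> real" where
  "kappa L n i z = real n * srv L i * z i"

section \<open>The driving Poisson processes and the controlled system\<close>

definition unit_poisson_process :: "'w measure \<Rightarrow> (real \<Rightarrow> 'w \<Rightarrow> nat) \<Rightarrow> bool" where
  "unit_poisson_process M P \<longleftrightarrow>
     (\<forall>t\<ge>0. P t \<in> measurable M (count_space UNIV)) \<and>
     (AE \<omega> in M. P 0 \<omega> = 0 \<and> mono_on {0..} (\<lambda>t. P t \<omega>) \<and>
        (\<forall>t\<ge>0. continuous (at_right t) (\<lambda>s. real (P s \<omega>)))) \<and>
     (\<forall>s t. 0 \<le> s \<longrightarrow> s \<le> t \<longrightarrow>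
        distr M (count_space UNIV) (\<lambda>\<omega>. P t \<omega> - P s \<omega>) = measure_pmf (poisson_pmf (t - s))) \<and>
     (\<forall>(\<tau> :: nat \<Rightarrow> real) k. 0 \<le> \<tau> 0 \<longrightarrow> mono \<tau> \<longrightarrow>
        prob_space.indep_vars M (\<lambda>_. count_space UNIV)
          (\<lambda>j \<omega>. P (\<tau> (Suc j)) \<omega> - P (\<tau> j) \<omega>) {..<k})"

datatype clock = Ax | Ay | Dx | Dy

definition driving_processes ::
    "'w measure \<Rightarrow> (clock \<Rightarrow> ('i::finite) \<Rightarrow> real \<Rightarrow> 'w \<Rightarrow> nat) \<Rightarrow> bool" where
  "driving_processes M N \<longleftrightarrow> prob_space M \<and>
     (\<forall>k i. unit_poisson_process M (N k i)) \<and>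
     prob_space.indep_vars M (\<lambda>_. \<Pi>\<^sub>M t\<in>{0..}. count_space UNIV)
       (\<lambda>(k, i) \<omega>. \<lambda>t\<in>{0..}. N k i t \<omega>) UNIV"

definition normalized :: "nat \<Rightarrow> ('i \<Rightarrow> real \<Rightarrow> 'w \<Rightarrow> nat) \<Rightarrow> real \<Rightarrow> 'w \<Rightarrow> 'i \<Rightarrow> real" where
  "normalized n X s \<omega> = (\<lambda>j. real (X j s \<omega>) / real n)"

text \<open>The state of the \<open>n\<close>th system solves the random time-change equations. Integrability is
  required because the integral operator is total.\<close>

definition penalty_system ::
    "'w measure \<Rightarrow> (clock \<Rightarrow> ('i::finite) \<Rightarrow> real \<Rightarrow> 'w \<Rightarrow> nat) \<Rightarrow> 'i loss_model \<Rightarrow>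
     real \<Rightarrow> ('i \<Rightarrow> real) \<Rightarrow> nat \<Rightarrow> ('i \<Rightarrow> nat) \<Rightarrow>
     ('i \<Rightarrow> real \<Rightarrow> 'w \<Rightarrow> nat) \<Rightarrow> ('i \<Rightarrow> real \<Rightarrow> 'w \<Rightarrow> nat) \<Rightarrow> bool" where
  "penalty_system M N L \<epsilon> \<alpha> n y0 X Y \<longleftrightarrow>
     (AE \<omega> in M. \<forall>i. \<forall>t\<ge>0.
        (\<lambda>s. nu_x L \<epsilon> \<alpha> n i (normalized n X s \<omega>) (normalized n Y s \<omega>)) integrable_on {0..t} \<and>
        (\<lambda>s. kappa L n i (normalized n X s \<omega>)) integrable_on {0..t} \<and>
        (\<lambda>s. kappa L n i (normalized n Y s \<omega>)) integrable_on {0..t} \<and>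
        real (X i t \<omega>) =
          real (N Ax i (integral {0..t} (\<lambda>s. nu_x L \<epsilon> \<alpha> n i
                  (normalized n X s \<omega>) (normalized n Y s \<omega>))) \<omega>)
          - real (N Dx i (integral {0..t} (\<lambda>s. kappa L n i (normalized n X s \<omega>))) \<omega>) \<and>
        real (Y i t \<omega>) = real (y0 i)
          + real (N Ay i (integral {0..t} (\<lambda>s. nu_y L \<epsilon> \<alpha> n i
                  (normalized n X s \<omega>) (normalized n Y s \<omega>))) \<omega>)
          - real (N Dy i (integral {0..t} (\<lambda>s. kappa L n i (normalized n Y s \<omega>))) \<omega>))"

text \<open>The prescribed load \<open>(1 - \<alpha> i) * load (scaled n L) i\<close> need not be an integer, while the
  number of requests is one. Both roundings are allowed; equality is forced for an integer load.\<close>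

definition initial_load ::
    "'i loss_model \<Rightarrow> ('i \<Rightarrow> real) \<Rightarrow> nat \<Rightarrow> ('i \<Rightarrow> nat) \<Rightarrow> bool" where
  "initial_load L \<alpha> n y0 \<longleftrightarrow>
     (\<forall>i. \<bar>real (y0 i) - (1 - \<alpha> i) * load (scaled n L) i\<bar> < 1)"

definition reward_rate ::
    "('i::finite) loss_model \<Rightarrow> nat \<Rightarrow> ('i \<Rightarrow> real \<Rightarrow> 'w \<Rightarrow> nat) \<Rightarrow> real \<Rightarrow> 'w \<Rightarrow> real" where
  "reward_rate L n X t \<omega> = (\<Sum>i\<in>UNIV. rew (scaled n L) i * real (X i t \<omega>))"

end

theory Submission
  imports Defs
begin

text \<open>
  Write \<open>\<rho> = load L i\<close>. The total number of class \<open>i\<close> requests in the original and the fictitious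
  system does not depend on the policy: normalized, it converges to \<open>z(t) = \<rho> (1 - \<alpha> exp (-\<mu> t))\<close>.
  Comparing the two exponential derivatives and taking logarithms turns the penalty rule into a
  threshold rule for each class separately: accept iff \<open>x \<le> \<alpha> z + \<eta>\<close>, with a constant \<open>\<eta>\<close>
  (called \<open>tilt\<close> below) of order \<open>\<epsilon>\<close>, because \<open>pen_beta \<epsilon> \<ge> 2 / \<epsilon>\<close>
  (\<open>accepts_below_threshold\<close>, \<open>tilt_bounds\<close>). Hence in the limit a class
  first accepts everything, following \<open>\<rho> (1 - exp (-\<mu> t))\<close>, until it meets the threshold, and from
  then on it slides along it. This gives the explicit limit
  \<open>x(t) = max 0 (min (\<rho> (1 - exp (-\<mu> t))) (\<alpha> z(t) + \<eta>))\<close>, called \<open>fluid\<close>. The classes decouple because the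
  program is solved for the capacity \<open>cap L / (1 + 4 \<epsilon>)\<close>: the factor \<open>1 + \<epsilon>\<close> by which the thresholds
  can exceed \<open>\<alpha> \<rho>\<close> leaves some capacity unused, so that the capacity test never rejects
  (\<open>fluid_capacity_slack\<close>).

  Convergence is a statement about single paths. Almost surely every driving Poisson process \<open>P\<close>
  satisfies \<open>P(a) = a + o(a)\<close>, so the time-change equations become integral equations with an error
  \<open>\<delta>\<close> that is uniform on bounded time intervals. The drift is discontinuous at the
  threshold, so that a Lipschitz argument fails, but it always points towards the fluid path: a
  trajectory above that path is rejecting, or at most accepting as much as the path itself, and below it
  accepting. A last-exit argument (\<open>last_exit_bound\<close>) therefore keeps it within \<open>3 \<delta>\<close> of that path
  (\<open>fluid_upper\<close>, \<open>fluid_lower\<close>). The upper bounds for all classes come first, since they are what makes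
  the capacity test harmless in the lower bounds.

  For the reward, \<open>x(t) \<ge> \<rho> \<alpha> (1 - exp (-\<mu> t)) - \<epsilon> \<rho>\<close> reduces the claim to comparing the transient
  rewards of \<open>\<alpha>e\<close> and \<open>\<alpha>s\<close>. If two solutions are ordered componentwise, their transient
  rewards differ by at most the difference of their values, and the values of \<open>\<alpha>e\<close> and of an optimum of
  \<open>L\<close> differ by at most \<open>4 \<epsilon>\<close> times the latter. Some optimal solution of \<open>L\<close> always lies above
  \<open>\<alpha>e\<close> (\<open>fill_up_to_optimal\<close>); \<open>consistent_choice\<close> says that \<open>\<alpha>s\<close> is such a
  solution or that all optimal solutions have the transient reward of \<open>\<alpha>s\<close>.
\<close>

section \<open>Law of large numbers for unit Poisson processes\<close>

text \<open>Shifting the index once and twice in the exponential series gives the first two factorial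
  moments \<open>r\<close> and \<open>r\<^sup>2\<close>, and \<open>(k - r)\<^sup>2 = k (k - 1) + (1 - 2 r) k + r\<^sup>2\<close>.\<close>

lemma poisson_second_moment_sums:
  fixes r :: real
  shows "(\<lambda>k. r ^ k / fact k * exp (- r) * (real k - r)\<^sup>2) sums r"
proof -
  let ?a = "\<lambda>k. r ^ k / fact k :: real"
  have a0: "?a sums exp r"
    using exp_converges[of r] by (simp add: divide_inverse mult.commute)
  have step: "real (Suc k) * ?a (Suc k) = r * ?a k" for k
    by (simp add: field_simps del: of_nat_Suc)
  have "(\<lambda>k. real (Suc k) * ?a (Suc k)) sums (r * exp r)"
    unfolding step by (intro sums_mult a0)
  then have a1: "(\<lambda>k. real k * ?a k) sums (r * exp r)"
    by (subst (asm) sums_Suc_iff) simp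
  have step2: "real (Suc k) * (real (Suc k) - 1) * ?a (Suc k) = r * (real k * ?a k)" for k
    using step[of k] by (simp only: of_nat_Suc mult.assoc mult.left_commute) simp
  have "(\<lambda>k. real (Suc k) * (real (Suc k) - 1) * ?a (Suc k)) sums (r * (r * exp r))"
    unfolding step2 by (intro sums_mult a1)
  then have a2: "(\<lambda>k. real k * (real k - 1) * ?a k) sums (r\<^sup>2 * exp r)"
    by (subst (asm) sums_Suc_iff) (simp add: power2_eq_square mult.assoc)
  have "(\<lambda>k. exp (- r) * (real k * (real k - 1) * ?a k + (1 - 2 * r) * (real k * ?a k) + r\<^sup>2 * ?a k))
      sums (exp (- r) * (r\<^sup>2 * exp r + (1 - 2 * r) * (r * exp r) + r\<^sup>2 * exp r))"
    by (intro sums_mult sums_add a0 a1 a2)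
  moreover have "exp (- r) * (r\<^sup>2 * exp r + (1 - 2 * r) * (r * exp r) + r\<^sup>2 * exp r) = r"
    by (simp add: exp_minus field_simps power2_eq_square)
  moreover have "exp (- r) * (real k * (real k - 1) * ?a k + (1 - 2 * r) * (real k * ?a k) + r\<^sup>2 * ?a k)
      = ?a k * exp (- r) * (real k - r)\<^sup>2" for k
  proof -
    have "e * (x * (x - 1) * A + (1 - 2 * r) * (x * A) + r\<^sup>2 * A) = A * e * (x - r)\<^sup>2" for e x A :: real
      by (simp add: power2_eq_square algebra_simps)
    then show ?thesis .
  qed
  ultimately show ?thesis by simp
qed

lemma poisson_pmf_variance:
  assumes "0 < r"
  shows "(\<integral>\<^sup>+ k. ennreal ((real k - r)\<^sup>2) \<partial>measure_pmf (poisson_pmf r)) = ennreal r"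
proof -
  have "(\<integral>\<^sup>+ k. ennreal ((real k - r)\<^sup>2) \<partial>measure_pmf (poisson_pmf r))
      = (\<Sum>k. ennreal (r ^ k / fact k * exp (- r) * (real k - r)\<^sup>2))"
    using assms
    by (simp only: nn_integral_measure_pmf nn_integral_count_space_nat pmf_poisson[OF assms])
      (simp only: ennreal_mult'' zero_le_power2)
  also have "\<dots> = ennreal r"
    using assms poisson_second_moment_sums[of r] by (intro suminf_ennreal_eq) auto
  finally show ?thesis .
qed

text \<open>This is \<open>P(a) = a + o(a)\<close>, in a form that also covers bounded \<open>a\<close> and therefore rescales to a
  uniform bound on \<open>[0, n K]\<close>.\<close>

definition sublinear_error :: "(real \<Rightarrow> nat) \<Rightarrow> bool" where
  "sublinear_error P \<longleftrightarrow> (\<forall>\<delta>>0. \<exists>C\<ge>0. \<forall>a\<ge>0. \<bar>real (P a) - a\<bar> \<le> C + \<delta> * a)"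

text \<open>Monotonicity extends the control from the squares to all times: consecutive squares
  \<open>k\<^sup>2 \<le> a \<le> (k + 1)\<^sup>2\<close> are only \<open>O(sqrt a)\<close> apart, and \<open>sqrt a\<close> is absorbed into \<open>d * a\<close> plus a constant.\<close>

lemma error_bound_from_squares:
  fixes P :: "real \<Rightarrow> nat"
  assumes mono: "mono_on {0..} P"
    and lim: "(\<lambda>k. (real (P ((real (Suc k))\<^sup>2)) - (real (Suc k))\<^sup>2) / (real (Suc k))\<^sup>2) \<longlonglongrightarrow> 0"
    and "0 < \<delta>"
  shows "\<exists>C\<ge>0. \<forall>a\<ge>0. \<bar>real (P a) - a\<bar> \<le> C + \<delta> * a"
proof -
  define d where "d = min 1 (\<delta> / 3)"
  have d: "0 < d" "d \<le> 1" "3 * d \<le> \<delta>" using \<open>0 < \<delta>\<close> by (auto simp: d_def)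
  define D where "D = 1 / d"
  have D: "1 \<le> D" using d by (simp add: D_def)
  obtain k0 where k0: "\<And>k. k \<ge> k0 \<Longrightarrow>
      \<bar>(real (P ((real (Suc k))\<^sup>2)) - (real (Suc k))\<^sup>2) / (real (Suc k))\<^sup>2\<bar> < d"
    using LIMSEQ_D[OF lim \<open>0 < d\<close>] by (auto simp del: of_nat_Suc)
  have sq: "\<bar>real (P ((real k)\<^sup>2)) - (real k)\<^sup>2\<bar> \<le> d * (real k)\<^sup>2" if "k > k0" for k
  proof -
    obtain j where j: "k = Suc j" "j \<ge> k0" using \<open>k > k0\<close> by (cases k) auto
    have "\<bar>real (P ((real k)\<^sup>2)) - (real k)\<^sup>2\<bar> / (real k)\<^sup>2 < d"
      using k0[OF j(2)] j(1) by (simp add: abs_divide del: of_nat_Suc)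
    then show ?thesis using j(1) by (simp add: field_simps del: of_nat_Suc)
  qed
  let ?A = "(real (Suc k0))\<^sup>2"
  have large: "\<bar>real (P a) - a\<bar> \<le> 3 * (d * a) + 8 * D" if a: "a \<ge> ?A" for a
  proof -
    define k where "k = nat \<lfloor>sqrt a\<rfloor>"
    have a0: "0 \<le> a" using a by (meson order_trans zero_le_power2)
    have "real (Suc k0) \<le> sqrt a" using a by (simp add: real_le_rsqrt)
    then have kk: "k > k0" unfolding k_def by linarith
    have k1: "real k \<le> sqrt a" "sqrt a < real k + 1" unfolding k_def using a0 by auto
    have le: "(real k)\<^sup>2 \<le> a" using k1(1) a0 by (metis of_nat_0_le_iff power_mono real_sqrt_pow2)
    have "(sqrt a)\<^sup>2 \<le> (real (Suc k))\<^sup>2" using k1(2) a0 by (intro power_mono) auto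
    then have ge: "a \<le> (real (Suc k))\<^sup>2" using a0 by (simp del: of_nat_Suc)
    have "P ((real k)\<^sup>2) \<le> P a" "P a \<le> P ((real (Suc k))\<^sup>2)"
      using mono_onD[OF mono, of "(real k)\<^sup>2" a] mono_onD[OF mono, of a "(real (Suc k))\<^sup>2"] le ge a0 by auto
    then have P: "real (P ((real k)\<^sup>2)) \<le> real (P a)" "real (P a) \<le> real (P ((real (Suc k))\<^sup>2))" by auto
    have up: "(real (Suc k))\<^sup>2 \<le> a + 2 * sqrt a + 1"
      using le k1(1) by (simp add: power2_eq_square algebra_simps)
    \<comment> \<open>The square is expanded to bound \<open>sqrt a\<close> by \<open>d * a\<close> and a constant.\<close>
    have "0 \<le> (d * sqrt a - 2)\<^sup>2" by simp
    then have "4 * d * sqrt a \<le> d\<^sup>2 * a + 4"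
      using a0 by (simp add: power2_eq_square algebra_simps)
    then have "4 * sqrt a \<le> (d\<^sup>2 * a + 4) / d"
      using d by (simp add: pos_le_divide_eq mult_ac)
    also have "\<dots> = d * a + 4 * D"
      using d by (simp add: D_def add_divide_distrib power2_eq_square)
    finally have amgm: "4 * sqrt a \<le> d * a + 4 * D" .
    have da: "0 \<le> d * a" using d a0 by simp
    have "real (P a) \<le> (1 + d) * (real (Suc k))\<^sup>2"
    proof -
      have "real (P ((real (Suc k))\<^sup>2)) - (real (Suc k))\<^sup>2 \<le> d * (real (Suc k))\<^sup>2"
        using sq[of "Suc k"] kk by (simp add: abs_le_iff del: of_nat_Suc)
      then show ?thesis using P(2) by (simp only: distrib_right mult_1)
    qed
    also have "\<dots> \<le> (1 + d) * (a + 2 * sqrt a + 1)" using up d by (intro mult_left_mono) auto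
    also have "\<dots> \<le> a + d * a + 2 * (2 * sqrt a + 1)"
    proof -
      have "d * (2 * sqrt a + 1) \<le> 1 * (2 * sqrt a + 1)" using d a0 by (intro mult_right_mono) auto
      then show ?thesis by (simp add: algebra_simps)
    qed
    finally have u: "real (P a) - a \<le> 3 * (d * a) + 8 * D"
      using amgm D da by argo
    have "(1 - d) * (real k)\<^sup>2 \<le> real (P a)"
      using sq[OF kk] P(1) by (simp only: abs_le_iff left_diff_distrib mult_1) linarith
    moreover have "d * (real k)\<^sup>2 \<le> d * a" using le d by (intro mult_left_mono) auto
    moreover have "a \<le> (real k)\<^sup>2 + 2 * sqrt a + 1"
      using ge k1(1) by (simp add: power2_eq_square algebra_simps)
    ultimately have "a - real (P a) \<le> d * a + 2 * sqrt a + 1"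
      by (simp only: left_diff_distrib mult_1)
    then have "a - real (P a) \<le> 3 * (d * a) + 8 * D"
      using amgm D da by argo
    then show ?thesis using u by linarith
  qed
  define C where "C = real (P ?A) + ?A + 8 * D"
  have C0: "0 \<le> C" using D by (simp add: C_def)
  have "\<bar>real (P a) - a\<bar> \<le> C + \<delta> * a" if "0 \<le> a" for a
  proof (cases "a \<ge> ?A")
    case True
    have "3 * (d * a) \<le> \<delta> * a"
      using mult_right_mono[OF d(3) that] by simp
    moreover have "8 * D \<le> C" by (simp add: C_def)
    ultimately show ?thesis using large[OF True] by linarith
  next
    case False
    then have "P a \<le> P ?A" using mono_onD[OF mono, of a ?A] that by auto
    then have "real (P a) \<le> real (P ?A)" by simp
    then have "\<bar>real (P a) - a\<bar> \<le> real (P ?A) + ?A" using False that by linarith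
    moreover have "real (P ?A) + ?A \<le> C" using D by (simp add: C_def)
    moreover have "0 \<le> \<delta> * a" using \<open>0 < \<delta>\<close> that by simp
    ultimately show ?thesis by linarith
  qed
  then show ?thesis using C0 by blast
qed

text \<open>By the variance formula, the relative error at time \<open>k\<^sup>2\<close> has second moment \<open>1 / k\<^sup>2\<close>, which is
  summable. Hence the sum of the squared errors is integrable, thus almost surely finite, and its terms
  tend to zero; monotonicity of the paths takes care of the times between the squares.\<close>

lemma poisson_process_sublinear_error:
  assumes "prob_space M" and P: "unit_poisson_process M P"
  shows "AE \<omega> in M. sublinear_error (\<lambda>t. P t \<omega>)"
proof -
  let ?s = "\<lambda>k. (real (Suc k))\<^sup>2"
  let ?f = "\<lambda>k \<omega>. ((real (P (?s k) \<omega>) - ?s k) / ?s k)\<^sup>2"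
  have meas: "P t \<in> measurable M (count_space UNIV)" if "t \<ge> 0" for t
    using P that by (auto simp: unit_poisson_process_def)
  have init: "AE \<omega> in M. P 0 \<omega> = 0 \<and> mono_on {0..} (\<lambda>t. P t \<omega>)"
    using P unfolding unit_poisson_process_def by (auto elim: AE_mp)
  have law: "distr M (count_space UNIV) (\<lambda>\<omega>. P t \<omega> - P 0 \<omega>) = measure_pmf (poisson_pmf t)"
    if "t \<ge> 0" for t
    using P that unfolding unit_poisson_process_def by (metis diff_zero order_refl)
  have mf[measurable]: "(\<lambda>\<omega>. ?f k \<omega>) \<in> borel_measurable M" for k
  proof -
    have [measurable]: "P (?s k) \<in> measurable M (count_space UNIV)" by (rule meas) simp
    show ?thesis by measurable
  qed
  have int: "(\<integral>\<^sup>+\<omega>. ennreal (?f k \<omega>) \<partial>M) = ennreal (1 / ?s k)" for k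
  proof -
    let ?t = "?s k"
    have t: "?t > 0" by simp
    have md: "(\<lambda>\<omega>. P ?t \<omega> - P 0 \<omega>) \<in> measurable M (count_space UNIV)"
    proof -
      have [measurable]: "P ?t \<in> measurable M (count_space UNIV)" "P 0 \<in> measurable M (count_space UNIV)"
        by (rule meas, simp)+
      show ?thesis by measurable
    qed
    have "(\<integral>\<^sup>+\<omega>. ennreal (?f k \<omega>) \<partial>M)
        = (\<integral>\<^sup>+\<omega>. ennreal (1 / ?t\<^sup>2) * ennreal ((real (P ?t \<omega> - P 0 \<omega>) - ?t)\<^sup>2) \<partial>M)"
      using init by (intro nn_integral_cong_AE)
        (auto elim!: AE_mp simp: power_divide ennreal_mult'[symmetric] simp del: of_nat_Suc)
    also have "\<dots> = (\<integral>\<^sup>+j. ennreal (1 / ?t\<^sup>2) * ennreal ((real j - ?t)\<^sup>2)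
        \<partial>distr M (count_space UNIV) (\<lambda>\<omega>. P ?t \<omega> - P 0 \<omega>))"
      using md by (subst nn_integral_distr) auto
    also have "\<dots> = ennreal (1 / ?t\<^sup>2) * ennreal ?t"
      using law[of ?t] t by (simp add: nn_integral_cmult poisson_pmf_variance del: of_nat_Suc)
    also have "\<dots> = ennreal (1 / ?t)"
      using t by (subst ennreal_mult[symmetric]) (auto simp: power2_eq_square simp del: of_nat_Suc)
    finally show ?thesis .
  qed
  have "summable (\<lambda>k. 1 / ?s k)"
    using inverse_power_summable[of 2, where 'a=real]
    by (subst summable_Suc_iff) (simp add: divide_inverse)
  then have fin: "(\<Sum>k. ennreal (1 / ?s k)) \<noteq> \<infinity>"
    by (subst suminf_ennreal2) auto
  have "(\<integral>\<^sup>+\<omega>. (\<Sum>k. ennreal (?f k \<omega>)) \<partial>M) = (\<Sum>k. ennreal (1 / ?s k))"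
    by (subst nn_integral_suminf) (simp_all add: int del: of_nat_Suc)
  then have "AE \<omega> in M. (\<Sum>k. ennreal (?f k \<omega>)) \<noteq> \<infinity>"
    using fin by (intro nn_integral_noteq_infinite) (simp_all del: of_nat_Suc)
  then show ?thesis
    using init
  proof eventually_elim
    case (elim \<omega>)
    then have "summable (\<lambda>k. ?f k \<omega>)" by (intro summable_suminf_not_top) auto
    then have "(\<lambda>k. ?f k \<omega>) \<longlonglongrightarrow> 0" by (rule summable_LIMSEQ_zero)
    then have "(\<lambda>k. (real (P (?s k) \<omega>) - ?s k) / ?s k) \<longlonglongrightarrow> 0"
      using tendsto_real_sqrt[of "\<lambda>k. ?f k \<omega>" 0 sequentially]
      by (simp add: tendsto_rabs_zero_iff del: of_nat_Suc)
    then show ?case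
      using elim error_bound_from_squares[of "\<lambda>t. P t \<omega>"] by (auto simp: sublinear_error_def)
  qed
qed

lemma sublinear_error_scaled:
  assumes "sublinear_error P" and "0 < \<delta>" and "0 \<le> K"
  shows "\<forall>\<^sub>F n in sequentially. \<forall>a. 0 \<le> a \<and> a \<le> real n * K \<longrightarrow> \<bar>real (P a) - a\<bar> \<le> \<delta> * real n"
proof -
  let ?d = "\<delta> / (2 * (K + 1))"
  have d: "?d > 0" using assms by simp
  obtain C where C: "C \<ge> 0" "\<And>a. a \<ge> 0 \<Longrightarrow> \<bar>real (P a) - a\<bar> \<le> C + ?d * a"
    using assms(1) d unfolding sublinear_error_def by meson
  have "\<forall>\<^sub>F n in sequentially. 2 * C / \<delta> \<le> real n"
    using filterlim_real_sequentially by (simp add: filterlim_at_top)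
  then show ?thesis
  proof eventually_elim
    case (elim n)
    show ?case
    proof (intro allI impI)
      fix a :: real assume a: "0 \<le> a \<and> a \<le> real n * K"
      have "?d * a \<le> ?d * (real n * (K + 1))"
        using a d by (intro mult_left_mono) (auto simp: algebra_simps)
      also have "\<dots> = \<delta> / 2 * real n" using \<open>0 \<le> K\<close> by (simp add: field_simps)
      finally have "?d * a \<le> \<delta> / 2 * real n" .
      then show "\<bar>real (P a) - a\<bar> \<le> \<delta> * real n"
      proof -
        have "C \<le> \<delta> / 2 * real n" using elim \<open>0 < \<delta>\<close> by (simp add: field_simps)
        then show ?thesis using C(2)[of a] a \<open>?d * a \<le> \<delta> / 2 * real n\<close> by linarith
      qed
    qed
  qed
qed

section \<open>Sensitivity of the linear program\<close>

text \<open>Otherwise moving a little capacity from class \<open>j\<close>, which uses some, to class \<open>i\<close>, which has room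
  for more, would increase the value.\<close>

lemma exchange_reward_per_capacity:
  assumes L: "valid_model L" and opt: "primal_optimal L \<alpha>" and j: "0 < \<alpha> j" and i: "\<alpha> i < 1"
  shows "rew L i / req L i \<le> rew L j / req L j"
proof (rule ccontr)
  assume "\<not> ?thesis"
  then have less: "rew L j / req L j < rew L i / req L i" by simp
  then have ij: "i \<noteq> j" by auto
  let ?w = "\<lambda>k. req L k * load L k"
  have b: "req L k > 0" and w: "?w k > 0" for k
    using L by (auto simp: valid_model_def load_def)
  have feas: "(\<Sum>k\<in>UNIV. ?w k * \<alpha> k) \<le> cap L" "\<And>k. 0 \<le> \<alpha> k \<and> \<alpha> k \<le> 1"
    using opt by (auto simp: primal_optimal_def primal_feasible_def)
  \<comment> \<open>The largest amount of capacity that class \<open>j\<close> can give up and class \<open>i\<close> can take.\<close>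
  define s where "s = min (?w j * \<alpha> j) (?w i * (1 - \<alpha> i))"
  have s: "0 < s" "s / ?w j \<le> \<alpha> j" "s / ?w i \<le> 1 - \<alpha> i"
  proof -
    show "0 < s" using j i w[of i] w[of j] by (simp add: s_def)
    show "s / ?w j \<le> \<alpha> j" using w[of j] by (simp add: s_def pos_divide_le_eq mult.commute)
    show "s / ?w i \<le> 1 - \<alpha> i" using w[of i] by (simp add: s_def pos_divide_le_eq mult.commute)
  qed
  define \<alpha>' where "\<alpha>' = \<alpha>(i := \<alpha> i + s / ?w i, j := \<alpha> j - s / ?w j)"
  have move: "(\<Sum>k\<in>UNIV. c k * \<alpha>' k) = (\<Sum>k\<in>UNIV. c k * \<alpha> k) + c i * (s / ?w i) - c j * (s / ?w j)"
    for c :: "'a \<Rightarrow> real"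
  proof -
    have "(\<Sum>k\<in>UNIV. c k * \<alpha>' k) = (\<Sum>k\<in>UNIV. c k * \<alpha> k + ((if k = i then c i * (s / ?w i) else 0)
        - (if k = j then c j * (s / ?w j) else 0)))"
      using ij by (intro sum.cong) (auto simp: \<alpha>'_def algebra_simps)
    then show ?thesis by (simp add: sum.distrib sum_subtractf)
  qed
  have "primal_feasible L \<alpha>'"
    unfolding primal_feasible_def
  proof (intro conjI allI)
    show "(\<Sum>k\<in>UNIV. ?w k * \<alpha>' k) \<le> cap L"
    proof -
      have "?w k * (s / ?w k) = s" for k using w[of k] by auto
      then show ?thesis using feas(1) by (simp add: move)
    qed
    have "0 \<le> s / ?w i" "0 \<le> s / ?w j" using s(1) w[of i] w[of j] by (simp_all add: less_imp_le)
    then show "0 \<le> \<alpha>' k" "\<alpha>' k \<le> 1" for k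
      using feas(2)[of k] feas(2)[of i] feas(2)[of j] s unfolding \<alpha>'_def by (auto; linarith)+
  qed
  moreover have "primal_value L \<alpha>' = primal_value L \<alpha> + s * (rew L i / req L i - rew L j / req L j)"
  proof -
    have "rew L k * load L k * (s / ?w k) = s * (rew L k / req L k)" for k
      using b[of k] w[of k] by (auto simp: field_simps)
    then show ?thesis unfolding primal_value_def move by (simp only: right_diff_distrib)
  qed
  moreover have "s * (rew L i / req L i - rew L j / req L j) > 0" using s less by simp
  ultimately show False using opt by (fastforce simp: primal_optimal_def)
qed

text \<open>Compare \<open>\<alpha>e\<close> with \<open>\<alpha>s\<close> on the sets \<open>U\<close> and \<open>D\<close> where \<open>\<alpha>e\<close> has to go up, respectively down, to
  reach \<open>\<alpha>s\<close>. The exchange property of both solutions forces all classes in \<open>U\<close> and \<open>D\<close> to have the same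
  reward \<open>p\<close> per capacity when neither set is empty. So only the net capacity \<open>WU - WD\<close> matters for the
  value, and instead of moving down on \<open>D\<close> it suffices to move up on \<open>U\<close> by the fraction \<open>(WU - WD) / WU\<close>. If
  the net amount is not positive, \<open>\<alpha>e\<close> is already optimal; if \<open>D\<close> is empty, \<open>\<alpha>s\<close> itself lies above \<open>\<alpha>e\<close>.\<close>

lemma fill_up_to_optimal:
  assumes L: "valid_model L" and os: "primal_optimal L \<alpha>s" and e: "0 \<le> \<epsilon>"
    and oe: "primal_optimal (shrunk \<epsilon> L) \<alpha>e"
  shows "\<exists>\<alpha>. primal_optimal L \<alpha> \<and> (\<forall>i. \<alpha>e i \<le> \<alpha> i)"
proof -
  let ?w = "\<lambda>k. req L k * load L k" and ?p = "\<lambda>k. rew L k / req L k"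
  have b: "req L k > 0" and w: "?w k > 0" and p0: "?p k \<ge> 0" for k
    using L by (auto simp: valid_model_def load_def less_imp_le)
  have Le: "valid_model (shrunk \<epsilon> L)"
    using L e by (auto simp: valid_model_def shrunk_def)
  have cap_le: "cap L / (1 + 4 * \<epsilon>) \<le> cap L"
    using L e by (simp add: valid_model_def field_simps)
  have le_simps: "rew (shrunk \<epsilon> L) = rew L" "req (shrunk \<epsilon> L) = req L" "load (shrunk \<epsilon> L) = load L"
    by (auto simp: shrunk_def load_def)
  have exs: "?p i \<le> ?p j" if "0 < \<alpha>s j" "\<alpha>s i < 1" for i j
    using exchange_reward_per_capacity[OF L os that] .
  have exe: "?p i \<le> ?p j" if "0 < \<alpha>e j" "\<alpha>e i < 1" for i j
    using exchange_reward_per_capacity[OF Le oe that] by (simp add: le_simps)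
  have fs: "(\<Sum>k\<in>UNIV. ?w k * \<alpha>s k) \<le> cap L" "\<And>k. 0 \<le> \<alpha>s k \<and> \<alpha>s k \<le> 1"
    using os by (auto simp: primal_optimal_def primal_feasible_def)
  have fe: "(\<Sum>k\<in>UNIV. ?w k * \<alpha>e k) \<le> cap L" "\<And>k. 0 \<le> \<alpha>e k \<and> \<alpha>e k \<le> 1"
    using oe cap_le by (auto simp: primal_optimal_def primal_feasible_def le_simps)
      (auto simp: shrunk_def)
  have opt_if: "primal_optimal L \<alpha>" if "primal_feasible L \<alpha>" "primal_value L \<alpha> \<ge> primal_value L \<alpha>s" for \<alpha>
    using os that by (fastforce simp: primal_optimal_def)
  have val: "primal_value L \<alpha> = (\<Sum>k\<in>UNIV. ?p k * (?w k * \<alpha> k))" for \<alpha>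
    unfolding primal_value_def using b by (intro sum.cong) (auto simp: field_simps less_imp_neq[symmetric])
  let ?D = "{i. \<alpha>s i < \<alpha>e i}" and ?U = "{i. \<alpha>e i < \<alpha>s i}"
  define up where "up k = max 0 (\<alpha>s k - \<alpha>e k)" for k
  define dn where "dn k = max 0 (\<alpha>e k - \<alpha>s k)" for k
  have split: "\<alpha>s k = \<alpha>e k + up k - dn k" for k by (auto simp: up_def dn_def)
  define WU where "WU = (\<Sum>k\<in>UNIV. ?w k * up k)"
  define WD where "WD = (\<Sum>k\<in>UNIV. ?w k * dn k)"
  have WD0: "WD \<ge> 0" "WU \<ge> 0"
    unfolding WD_def WU_def
    by (rule sum_nonneg; rule mult_nonneg_nonneg; use w in \<open>simp add: dn_def up_def less_imp_le\<close>)+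
  have Ws: "(\<Sum>k\<in>UNIV. ?w k * \<alpha>s k) = (\<Sum>k\<in>UNIV. ?w k * \<alpha>e k) + WU - WD"
    by (simp add: WU_def WD_def sum.distrib[symmetric] sum_subtractf[symmetric] split algebra_simps)
  show ?thesis
  proof (cases "?D = {}")
    case True
    then have "\<forall>i. \<alpha>e i \<le> \<alpha>s i" by (auto simp: not_less)
    then show ?thesis using os by blast
  next
    case False
    then obtain d where d: "d \<in> ?D" by blast
    have price: "?p k = ?p d" if "k \<in> ?U" for k
      using d that exs[of k d] exe[of d k] exs[of d k] exe[of k d] fs(2)[of k] fe(2)[of k] fs(2)[of d] fe(2)[of d]
      by fastforce
    define p where "p = ?p d"
    have pd: "?p k = p" if "k \<in> ?D" "?U \<noteq> {}" for k
    proof -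
      obtain l where l: "l \<in> ?U" using \<open>?U \<noteq> {}\<close> by blast
      have "?p k = ?p l"
        using l that exs[of k l] exe[of l k] fs(2)[of k] fe(2)[of k] fs(2)[of l] fe(2)[of l]
          exs[of l k] exe[of k l] by fastforce
      then show ?thesis using price[OF l] by (simp add: p_def)
    qed
    have pu: "?p k * (?w k * up k) = p * (?w k * up k)" for k
      using price[of k] by (cases "k \<in> ?U") (auto simp: p_def up_def)
    have diff: "primal_value L \<alpha>s = primal_value L \<alpha>e + p * WU - (\<Sum>k\<in>UNIV. ?p k * (?w k * dn k))"
      unfolding val WU_def sum_distrib_left pu[symmetric] sum.distrib[symmetric] sum_subtractf[symmetric]
      by (rule sum.cong) (auto simp: split algebra_simps)
    show ?thesis
    proof (cases "WU \<le> WD")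
      case True
      have "p * WU \<le> (\<Sum>k\<in>UNIV. ?p k * (?w k * dn k))"
      proof (cases "?U = {}")
        case True
        then have "up k = 0" for k by (auto simp: up_def not_less)
        then have "WU = 0" by (simp add: WU_def)
        moreover have "0 \<le> ?p k * (?w k * dn k)" for k
          by (rule mult_nonneg_nonneg[OF p0 mult_nonneg_nonneg[OF less_imp_le[OF w]]]) (simp add: dn_def)
        ultimately show ?thesis by (auto intro: sum_nonneg)
      next
        case False
        have "?p k * (?w k * dn k) = p * (?w k * dn k)" for k
          using pd[OF _ False, of k] by (cases "k \<in> ?D") (auto simp: dn_def)
        then have "(\<Sum>k\<in>UNIV. ?p k * (?w k * dn k)) = p * WD"
          unfolding WD_def sum_distrib_left by (intro sum.cong) auto
        moreover have "p * WU \<le> p * WD" using True p0[of d] unfolding p_def by (rule mult_left_mono)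
        ultimately show ?thesis by simp
      qed
      then have "primal_optimal L \<alpha>e"
        using diff fe by (intro opt_if) (auto simp: primal_feasible_def)
      then show ?thesis by blast
    next
      case False
      have "?U \<noteq> {}"
      proof
        assume "?U = {}"
        then have "up k = 0" for k by (auto simp: up_def not_less)
        then have "WU = 0" by (simp add: WU_def)
        then show False using False WD0 by simp
      qed
      have "?p k * (?w k * dn k) = p * (?w k * dn k)" for k
        using pd[OF _ \<open>?U \<noteq> {}\<close>, of k] by (cases "k \<in> ?D") (auto simp: dn_def)
      then have "(\<Sum>k\<in>UNIV. ?p k * (?w k * dn k)) = p * WD"
        unfolding WD_def sum_distrib_left by (intro sum.cong) auto
      then have vs: "primal_value L \<alpha>s = primal_value L \<alpha>e + p * (WU - WD)"
        using diff by (simp add: algebra_simps)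
      define s where "s = (WU - WD) / WU"
      have s: "0 \<le> s" "s \<le> 1" "s * WU = WU - WD" using False WD0 by (auto simp: s_def field_simps)
      define \<alpha> where "\<alpha> k = \<alpha>e k + s * up k" for k
      have bd: "\<alpha>e k \<le> \<alpha> k" "\<alpha> k \<le> 1" for k
      proof -
        have u: "0 \<le> up k" "\<alpha>e k + up k \<le> 1" using fs(2)[of k] fe(2)[of k] by (auto simp: up_def)
        then show "\<alpha>e k \<le> \<alpha> k" using s by (simp add: \<alpha>_def)
        have "s * up k \<le> 1 * up k" using s u by (intro mult_right_mono) auto
        then show "\<alpha> k \<le> 1" using u by (simp add: \<alpha>_def)
      qed
      have "(\<Sum>k\<in>UNIV. ?w k * \<alpha> k) = (\<Sum>k\<in>UNIV. ?w k * \<alpha>e k) + s * WU"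
        by (simp add: \<alpha>_def WU_def sum_distrib_left sum.distrib algebra_simps)
      then have "primal_feasible L \<alpha>"
        unfolding primal_feasible_def using bd Ws fs(1) s(3) fe(2) by (metis (no_types, lifting) add_diff_eq order_trans)
      moreover have "primal_value L \<alpha> = primal_value L \<alpha>e + p * (s * WU)"
        unfolding val WU_def sum_distrib_left sum.distrib[symmetric]
        by (rule sum.cong) (use pu in \<open>auto simp: \<alpha>_def algebra_simps\<close>)
      ultimately have "primal_optimal L \<alpha>" using vs s(3) by (intro opt_if) auto
      then show ?thesis using bd by blast
    qed
  qed
qed

text \<open>Dividing an optimal solution by \<open>1 + 4 \<epsilon>\<close> makes it feasible for the shrunk capacity.\<close>

lemma shrunk_value_loss:
  assumes L: "valid_model L" and os: "primal_optimal L \<alpha>" and e: "0 \<le> \<epsilon>"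
    and oe: "primal_optimal (shrunk \<epsilon> L) \<alpha>e"
  shows "primal_value L \<alpha> - primal_value L \<alpha>e \<le> 4 * \<epsilon> * primal_value L \<alpha>"
proof -
  let ?\<alpha> = "\<lambda>i. \<alpha> i / (1 + 4 * \<epsilon>)"
  have f: "(\<Sum>k\<in>UNIV. req L k * load L k * \<alpha> k) \<le> cap L" "\<And>k. 0 \<le> \<alpha> k \<and> \<alpha> k \<le> 1"
    using os by (auto simp: primal_optimal_def primal_feasible_def)
  have v0: "primal_value L \<alpha> \<ge> 0"
    unfolding primal_value_def using L f(2)
    by (auto intro!: sum_nonneg mult_nonneg_nonneg simp: valid_model_def load_def less_imp_le)
  have val_eq: "primal_value (shrunk \<epsilon> L) = primal_value L"
    by (auto simp: shrunk_def primal_value_def load_def fun_eq_iff)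
  have "primal_feasible (shrunk \<epsilon> L) ?\<alpha>"
    unfolding primal_feasible_def
  proof (intro conjI allI)
    show "(\<Sum>k\<in>UNIV. req (shrunk \<epsilon> L) k * load (shrunk \<epsilon> L) k * ?\<alpha> k) \<le> cap (shrunk \<epsilon> L)"
    proof -
      have "(\<Sum>k\<in>UNIV. req L k * load L k * ?\<alpha> k) = (\<Sum>k\<in>UNIV. req L k * load L k * \<alpha> k) / (1 + 4 * \<epsilon>)"
        by (simp add: sum_divide_distrib)
      also have "\<dots> \<le> cap L / (1 + 4 * \<epsilon>)" using f(1) e by (intro divide_right_mono) auto
      finally show ?thesis by (simp add: shrunk_def load_def)
    qed
    show "0 \<le> ?\<alpha> k" "?\<alpha> k \<le> 1" for k
      using f(2)[of k] e by (auto simp: divide_le_eq_1)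
  qed
  then have "primal_value L ?\<alpha> \<le> primal_value L \<alpha>e"
    using oe by (auto simp: primal_optimal_def val_eq)
  moreover have "primal_value L ?\<alpha> = primal_value L \<alpha> / (1 + 4 * \<epsilon>)"
    by (simp add: primal_value_def sum_divide_distrib)
  moreover have "primal_value L \<alpha> - primal_value L \<alpha> / (1 + 4 * \<epsilon>) \<le> 4 * \<epsilon> * primal_value L \<alpha>"
  proof -
    have "primal_value L \<alpha> * (1 - 4 * \<epsilon>) * (1 + 4 * \<epsilon>) \<le> primal_value L \<alpha>"
    proof -
      have "primal_value L \<alpha> * (1 - 4 * \<epsilon>) * (1 + 4 * \<epsilon>) = primal_value L \<alpha> - primal_value L \<alpha> * (4 * \<epsilon>)\<^sup>2"
        by (simp add: power2_eq_square algebra_simps)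
      then show ?thesis using v0 by simp
    qed
    then have "primal_value L \<alpha> * (1 - 4 * \<epsilon>) \<le> primal_value L \<alpha> / (1 + 4 * \<epsilon>)"
      using e by (simp add: pos_le_divide_eq)
    then show ?thesis by (simp add: algebra_simps)
  qed
  ultimately show ?thesis by linarith
qed

lemma transient_reward_diff_le_value_diff:
  assumes L: "valid_model L" and le: "\<And>i. \<alpha>e i \<le> \<alpha> i" and t: "t \<ge> 0"
  shows "transient_reward L \<alpha> t - transient_reward L \<alpha>e t \<le> primal_value L \<alpha> - primal_value L \<alpha>e"
proof -
  have "(rew L i * load L i * (\<alpha> i - \<alpha>e i)) * (1 - exp (- srv L i * t)) \<le> rew L i * load L i * (\<alpha> i - \<alpha>e i)" for i
    using L le[of i] by (intro mult_left_le mult_nonneg_nonneg) (auto simp: valid_model_def load_def less_imp_le)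
  then show ?thesis
    unfolding transient_reward_def primal_value_def sum_subtractf[symmetric]
    by (intro sum_mono) (simp add: algebra_simps)
qed

text \<open>The comparison goes through an optimal solution above \<open>\<alpha>e\<close>, where the difference of the transient
  rewards is at most the difference of the values.\<close>

lemma transient_reward_shrunk:
  assumes L: "valid_model L" and os: "primal_optimal L \<alpha>s" and e: "0 \<le> \<epsilon>"
    and oe: "primal_optimal (shrunk \<epsilon> L) \<alpha>e" and cc: "consistent_choice L \<alpha>s \<alpha>e" and t: "t \<ge> 0"
  shows "transient_reward L \<alpha>s t - 4 * \<epsilon> * primal_value L \<alpha>s \<le> transient_reward L \<alpha>e t"
proof -
  obtain \<alpha> where \<alpha>: "primal_optimal L \<alpha>" "\<And>i. \<alpha>e i \<le> \<alpha> i"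
      "transient_reward L \<alpha> t = transient_reward L \<alpha>s t"
    using cc fill_up_to_optimal[OF L os e oe] os t unfolding consistent_choice_def by metis
  have "primal_value L \<alpha> = primal_value L \<alpha>s"
    using \<alpha>(1) os by (simp add: primal_optimal_def antisym)
  then show ?thesis
    using transient_reward_diff_le_value_diff[of L \<alpha>e \<alpha> t, OF L \<alpha>(2) t] shrunk_value_loss[OF L \<alpha>(1) e oe] \<alpha>(3) by simp
qed

section \<open>Comparison by the last exit\<close>

text \<open>Since the last time \<open>\<sigma>\<close> at which \<open>d \<le> \<gamma>\<close>, the drift \<open>\<phi>\<close> has been nonpositive, so that only the
  error \<open>\<delta>\<close> can have been gained. The function \<open>d\<close> may jump and \<open>\<phi>\<close> may be discontinuous, as they are for
  the queueing paths below; this is why \<open>\<sigma>\<close> is approached from the left, at the cost of a short piece on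
  which \<open>\<phi> \<le> B\<close> is used.\<close>

lemma last_exit_bound:
  fixes d \<phi> :: "real \<Rightarrow> real"
  assumes int: "\<phi> integrable_on {0..T}"
    and inc: "\<And>s t. 0 \<le> s \<Longrightarrow> s \<le> t \<Longrightarrow> t \<le> T \<Longrightarrow> d t - d s \<le> integral {s..t} \<phi> + \<delta>"
    and bnd: "\<And>r. 0 \<le> r \<Longrightarrow> r \<le> T \<Longrightarrow> \<phi> r \<le> B"
    and drift: "\<And>r. 0 \<le> r \<Longrightarrow> r \<le> T \<Longrightarrow> \<gamma> < d r \<Longrightarrow> \<phi> r \<le> 0"
    and init: "d 0 \<le> \<gamma>" and "0 \<le> \<delta>" and t: "0 \<le> t" "t \<le> T"
  shows "d t \<le> \<gamma> + \<delta>"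
proof -
  have sub: "\<phi> integrable_on {p..q}" if "0 \<le> p" "q \<le> T" for p q
    using that by (intro integrable_subinterval_real[OF int]) auto
  define S where "S = {r. 0 \<le> r \<and> r \<le> t \<and> d r \<le> \<gamma>}"
  define \<sigma> where "\<sigma> = Sup S"
  have S: "0 \<in> S" "bdd_above S"
  proof -
    show "0 \<in> S" using init t by (simp add: S_def)
    show "bdd_above S" by (rule bdd_aboveI[of _ t]) (simp add: S_def)
  qed
  have \<sigma>: "0 \<le> \<sigma>" "\<sigma> \<le> t"
  proof -
    show "0 \<le> \<sigma>" unfolding \<sigma>_def by (rule cSup_upper[OF S])
    show "\<sigma> \<le> t" unfolding \<sigma>_def using S(1) by (intro cSup_least) (auto simp: S_def)
  qed
  have after: "\<phi> r \<le> 0" if "\<sigma> < r" "r \<le> t" for r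
  proof -
    have "r \<notin> S" using that cSup_upper[OF _ S(2), of r] by (auto simp: \<sigma>_def)
    then show ?thesis using that \<sigma> t by (intro drift) (auto simp: S_def)
  qed
  have neg: "integral {\<sigma>..t} \<phi> \<le> 0"
  proof -
    let ?g = "\<lambda>r. if r = \<sigma> then 0 else \<phi> r"
    have "integral {\<sigma>..t} \<phi> = integral {\<sigma>..t} ?g"
      by (rule integral_spike[of "{\<sigma>}"]) auto
    also have "\<dots> \<le> integral {\<sigma>..t} (\<lambda>_. 0)"
    proof (rule integral_le)
      show "?g integrable_on {\<sigma>..t}"
        by (rule integrable_spike[OF sub[OF \<sigma>(1) t(2)], of "{\<sigma>}"]) auto
    qed (use after \<sigma> in auto)
    finally show ?thesis by simp
  qed
  show ?thesis
  proof (rule field_le_epsilon)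
    fix e :: real assume "0 < e"
    define K where "K = \<bar>B\<bar> + 1"
    have K: "0 < K" "B \<le> K" by (simp_all add: K_def)
    then have "\<sigma> - e / K < \<sigma>" using \<open>0 < e\<close> by simp
    then have "\<exists>r\<in>S. \<sigma> - e / K < r"
      unfolding \<sigma>_def using S by (subst (asm) less_cSup_iff) auto
    then obtain r where r: "r \<in> S" "\<sigma> - e / K < r" by blast
    have r2: "0 \<le> r" "r \<le> \<sigma>" "d r \<le> \<gamma>"
      using r(1) cSup_upper[OF r(1) S(2)] by (simp_all add: S_def \<sigma>_def)
    have "integral {r..\<sigma>} \<phi> \<le> integral {r..\<sigma>} (\<lambda>_. K)"
    proof (rule integral_le[OF sub])
      fix q assume "q \<in> {r..\<sigma>}"
      then have "\<phi> q \<le> B" using r2 \<sigma> t by (intro bnd) auto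
      then show "\<phi> q \<le> K" using K by linarith
    qed (use r2 \<sigma> t in auto)
    also have "\<dots> = K * (\<sigma> - r)" using r2 by simp
    also have "\<dots> \<le> K * (e / K)"
      by (rule mult_left_mono) (use r(2) K in linarith)+
    also have "\<dots> = e" using K by simp
    finally have "integral {r..\<sigma>} \<phi> \<le> e" .
    moreover have "integral {r..\<sigma>} \<phi> + integral {\<sigma>..t} \<phi> = integral {r..t} \<phi>"
      by (rule Henstock_Kurzweil_Integration.integral_combine[OF r2(2) \<sigma>(2) sub[OF r2(1) t(2)]])
    moreover have "d t - d r \<le> integral {r..t} \<phi> + \<delta>"
      using r2 \<sigma> t by (intro inc) linarith+
    ultimately show "d t \<le> \<gamma> + \<delta> + e" using neg r2(3) by linarith
  qed
qed

section \<open>The fluid path of one class\<close>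

text \<open>The solution of \<open>f' = lam - mu f\<close> that starts at \<open>lam / mu * (1 - c)\<close>. For \<open>c = 1\<close> this is a class all
  of whose arrivals are accepted; for \<open>c = \<alpha>\<close> it is the total of a class over both systems.\<close>

definition relax :: "real \<Rightarrow> real \<Rightarrow> real \<Rightarrow> real \<Rightarrow> real" where
  "relax lam mu c t = lam / mu * (1 - c * exp (- mu * t))"

definition threshold :: "real \<Rightarrow> real \<Rightarrow> real \<Rightarrow> real \<Rightarrow> real \<Rightarrow> real" where
  "threshold lam mu \<alpha> \<eta> t = \<alpha> * relax lam mu \<alpha> t + \<eta>"

text \<open>Full acceptance until the threshold is met, then sliding along the threshold. The maximum with
  zero matters only for a very negative \<open>\<eta>\<close>, when the threshold is negative at first and every arrival is
  rejected until it becomes positive.\<close>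

definition fluid :: "real \<Rightarrow> real \<Rightarrow> real \<Rightarrow> real \<Rightarrow> real \<Rightarrow> real" where
  "fluid lam mu \<alpha> \<eta> t = max 0 (min (relax lam mu 1 t) (threshold lam mu \<alpha> \<eta> t))"

lemma relax_has_integral:
  assumes "0 < mu" "s \<le> t"
  shows "((\<lambda>r. lam - mu * relax lam mu c r) has_integral relax lam mu c t - relax lam mu c s) {s..t}"
proof (rule fundamental_theorem_of_calculus[OF assms(2)])
  fix r
  have "((\<lambda>r. relax lam mu c r) has_real_derivative (lam - mu * relax lam mu c r)) (at r within {s..t})"
    unfolding relax_def using assms(1) by (auto intro!: derivative_eq_intros simp: field_simps)
  then show "((\<lambda>r. relax lam mu c r) has_vector_derivative (lam - mu * relax lam mu c r)) (at r within {s..t})"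
    by (simp add: has_real_derivative_iff_has_vector_derivative)
qed

lemma continuous_on_relax: "continuous_on S (relax lam mu c)"
  unfolding relax_def by (intro continuous_intros)

lemma continuous_on_min_relax_threshold:
  "continuous_on S (\<lambda>t. min (relax lam mu 1 t) (threshold lam mu \<alpha> \<eta> t))"
  unfolding threshold_def relax_def by (intro continuous_intros)

lemma relax_bounds:
  assumes "0 < lam" "0 < mu" "0 \<le> c" "c \<le> 1" "0 \<le> t"
  shows "0 \<le> relax lam mu c t" "relax lam mu c t \<le> lam / mu"
proof -
  have "c * exp (- mu * t) \<le> 1" "0 \<le> c * exp (- mu * t)"
    using assms by (auto intro!: mult_le_one)
  then show "0 \<le> relax lam mu c t" "relax lam mu c t \<le> lam / mu"
    using assms mult_left_le[of "1 - c * exp (- mu * t)" "lam / mu"] by (simp_all add: relax_def)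
qed

lemma relax_mono:
  assumes "0 < lam" "0 < mu" "0 \<le> c" "s \<le> t"
  shows "relax lam mu c s \<le> relax lam mu c t"
proof -
  have "exp (- mu * t) \<le> exp (- mu * s)" using assms by simp
  then have "c * exp (- mu * t) \<le> c * exp (- mu * s)" using assms by (intro mult_left_mono) auto
  then show ?thesis using assms unfolding relax_def by (intro mult_left_mono) auto
qed

text \<open>The condition on \<open>\<eta>\<close> says that full acceptance pushes upwards at least as fast as the threshold
  rises, which is needed to stay on it.\<close>

lemma threshold_le_integral:
  assumes "0 < lam" "0 < mu" "s \<le> t" and \<eta>: "\<eta> \<le> lam / mu * (1 - \<alpha>)"
  shows "threshold lam mu \<alpha> \<eta> t - threshold lam mu \<alpha> \<eta> s
    \<le> integral {s..t} (\<lambda>r. lam - mu * threshold lam mu \<alpha> \<eta> r)"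
proof -
  have I: "((\<lambda>r. \<alpha> * (lam - mu * relax lam mu \<alpha> r)) has_integral
      \<alpha> * (relax lam mu \<alpha> t - relax lam mu \<alpha> s)) {s..t}"
    using relax_has_integral[OF assms(2,3)] by (rule has_integral_mult_right)
  have "mu * \<eta> \<le> lam * (1 - \<alpha>)" using mult_left_mono[OF \<eta>, of mu] assms by simp
  then have le: "\<alpha> * (lam - mu * relax lam mu \<alpha> r) \<le> lam - mu * threshold lam mu \<alpha> \<eta> r" for r
    by (simp add: threshold_def algebra_simps)
  have "threshold lam mu \<alpha> \<eta> t - threshold lam mu \<alpha> \<eta> s = \<alpha> * (relax lam mu \<alpha> t - relax lam mu \<alpha> s)"
    by (simp add: threshold_def algebra_simps)
  also have "\<dots> = integral {s..t} (\<lambda>r. \<alpha> * (lam - mu * relax lam mu \<alpha> r))"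
    by (rule integral_unique[OF I, symmetric])
  also have "\<dots> \<le> integral {s..t} (\<lambda>r. lam - mu * threshold lam mu \<alpha> \<eta> r)"
    using I le unfolding threshold_def
    by (intro integral_le) (auto intro!: integrable_continuous_real continuous_intros continuous_on_relax)
  finally show ?thesis .
qed

text \<open>Both branches grow at most like full acceptance would make them grow, and the inequality passes to
  their minimum: follow from \<open>s\<close> the branch that is smaller there, and use that the drift \<open>lam - mu f\<close> is
  larger for smaller \<open>f\<close>. If \<open>\<eta>\<close> violates the condition of \<open>threshold_le_integral\<close>, the threshold
  is never met and only the first branch counts.\<close>

lemma min_relax_threshold_le_integral:
  assumes "0 < lam" "0 < mu" "0 \<le> s" "s \<le> t" "0 \<le> \<alpha>" "\<alpha> \<le> 1"
  shows "min (relax lam mu 1 t) (threshold lam mu \<alpha> \<eta> t) - min (relax lam mu 1 s) (threshold lam mu \<alpha> \<eta> s)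
    \<le> integral {s..t} (\<lambda>r. lam - mu * min (relax lam mu 1 r) (threshold lam mu \<alpha> \<eta> r))"
    (is "?m t - ?m s \<le> integral _ ?\<phi>")
proof -
  have \<phi>: "?\<phi> integrable_on {s..t}"
    by (intro integrable_continuous_real continuous_intros continuous_on_min_relax_threshold)
  have full: "relax lam mu 1 t - relax lam mu 1 s \<le> integral {s..t} ?\<phi>"
  proof (rule has_integral_le[OF relax_has_integral[OF assms(2,4)] integrable_integral[OF \<phi>]])
    show "lam - mu * relax lam mu 1 r \<le> ?\<phi> r" for r using assms by (simp add: mult_left_mono)
  qed
  show ?thesis
  proof (cases "?m s = relax lam mu 1 s")
    case True
    then show ?thesis using full by linarith
  next
    case False
    then have ms: "?m s = threshold lam mu \<alpha> \<eta> s" "threshold lam mu \<alpha> \<eta> s < relax lam mu 1 s" by linarith+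
    have "\<eta> \<le> lam / mu * (1 - \<alpha>)"
    proof (rule ccontr)
      assume "\<not> ?thesis"
      moreover have "(1 - \<alpha>\<^sup>2) * exp (- mu * s) \<ge> 0"
        using assms by (simp add: power_le_one)
      then have "lam / mu * ((1 - \<alpha>\<^sup>2) * exp (- mu * s)) \<ge> 0" using assms by simp
      moreover have "relax lam mu 1 s = threshold lam mu \<alpha> \<eta> s - lam / mu * ((1 - \<alpha>\<^sup>2) * exp (- mu * s))
          - (\<eta> - lam / mu * (1 - \<alpha>))"
      proof -
        have "k * (1 - 1 * e) = \<alpha> * (k * (1 - \<alpha> * e)) + \<eta> - k * ((1 - \<alpha>\<^sup>2) * e) - (\<eta> - k * (1 - \<alpha>))"
          for k e :: real
          by (simp add: algebra_simps power2_eq_square)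
        then show ?thesis unfolding threshold_def relax_def .
      qed
      ultimately show False using ms(2) by linarith
    qed
    then have "threshold lam mu \<alpha> \<eta> t - threshold lam mu \<alpha> \<eta> s
        \<le> integral {s..t} (\<lambda>r. lam - mu * threshold lam mu \<alpha> \<eta> r)"
      using assms by (intro threshold_le_integral)
    also have "\<dots> \<le> integral {s..t} ?\<phi>"
    proof (rule integral_le[OF _ \<phi>])
      show "(\<lambda>r. lam - mu * threshold lam mu \<alpha> \<eta> r) integrable_on {s..t}"
        unfolding threshold_def
        by (intro integrable_continuous_real continuous_intros continuous_on_relax)
      show "lam - mu * threshold lam mu \<alpha> \<eta> r \<le> ?\<phi> r" for r using assms by (simp add: mult_left_mono)
    qed
    finally show ?thesis using ms(1) by linarith
  qed
qed

section \<open>Trajectories near the fluid path\<close>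

text \<open>A trajectory of one class that solves the fluid equations up to an error \<open>\<delta>\<close>: \<open>x\<close> and \<open>y\<close> are the
  normalized numbers in the original and the fictitious system, and \<open>a\<close> is the accepted fraction of the arrivals.
  Rejection above the threshold is assumed here, acceptance below it only where it is used, because it
  presupposes that there is free capacity.\<close>

locale near_fluid_class =
  fixes lam mu \<alpha> \<eta> T \<delta> :: real and x y a :: "real \<Rightarrow> real"
  assumes pos: "0 < lam" "0 < mu" and \<alpha>: "0 \<le> \<alpha>" "\<alpha> \<le> 1" and \<delta>: "0 \<le> \<delta>"
    and nonneg: "\<And>r. 0 \<le> r \<Longrightarrow> r \<le> T \<Longrightarrow> 0 \<le> x r" "\<And>r. 0 \<le> r \<Longrightarrow> r \<le> T \<Longrightarrow> 0 \<le> y r"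
    and integrable: "a integrable_on {0..T}" "x integrable_on {0..T}" "y integrable_on {0..T}"
    and a01: "\<And>r. 0 \<le> r \<Longrightarrow> r \<le> T \<Longrightarrow> 0 \<le> a r" "\<And>r. 0 \<le> r \<Longrightarrow> r \<le> T \<Longrightarrow> a r \<le> 1"
    and x_inc: "\<And>s t. 0 \<le> s \<Longrightarrow> s \<le> t \<Longrightarrow> t \<le> T \<Longrightarrow>
      \<bar>x t - x s - integral {s..t} (\<lambda>r. lam * a r - mu * x r)\<bar> \<le> \<delta>"
    and z_inc: "\<And>s t. 0 \<le> s \<Longrightarrow> s \<le> t \<Longrightarrow> t \<le> T \<Longrightarrow>
      \<bar>(x t + y t) - (x s + y s) - integral {s..t} (\<lambda>r. lam - mu * (x r + y r))\<bar> \<le> \<delta>"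
    and x0: "x 0 \<le> \<delta>" and z0: "\<bar>x 0 + y 0 - lam / mu * (1 - \<alpha>)\<bar> \<le> \<delta>"
    and reject: "\<And>r. 0 \<le> r \<Longrightarrow> r \<le> T \<Longrightarrow> \<alpha> * (x r + y r) + \<eta> < x r \<Longrightarrow> a r = 0"
begin

lemma integrable_sub: "f integrable_on {0..T} \<Longrightarrow> 0 \<le> s \<Longrightarrow> t \<le> T \<Longrightarrow> f integrable_on {s..t}"
  for f :: "real \<Rightarrow> real"
  by (rule integrable_subinterval_real) auto

lemma relax_integrable: "relax lam mu c integrable_on {s..t}"
  by (intro integrable_continuous_real continuous_on_relax)

lemma total_upper:
  assumes t: "0 \<le> t" "t \<le> T"
  shows "x t + y t - relax lam mu \<alpha> t \<le> 2 * \<delta>"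
proof -
  let ?d = "\<lambda>t. x t + y t - relax lam mu \<alpha> t"
  let ?\<phi> = "\<lambda>r. (lam - mu * (x r + y r)) - (lam - mu * relax lam mu \<alpha> r)"
  have "?d t \<le> \<delta> + \<delta>"
  proof (rule last_exit_bound[where d = ?d and \<phi> = ?\<phi> and B = "mu * (lam / mu)" and T = T])
    show "?\<phi> integrable_on {0..T}"
      by (intro integrable_diff integrable_on_mult_right integrable_add integrable relax_integrable
          integrable_const_ivl)
    fix s t assume st: "0 \<le> s" "s \<le> t" "t \<le> T"
    have "integral {s..t} ?\<phi> = integral {s..t} (\<lambda>r. lam - mu * (x r + y r))
        - (relax lam mu \<alpha> t - relax lam mu \<alpha> s)"
      using st integral_unique[OF relax_has_integral[OF pos(2) st(2)], of lam \<alpha>]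
      by (subst integral_diff)
        (auto intro!: integrable_diff integrable_on_mult_right integrable_add integrable_sub[OF integrable(2)]
          integrable_sub[OF integrable(3)] relax_integrable)
    then show "?d t - ?d s \<le> integral {s..t} ?\<phi> + \<delta>" using z_inc[OF st] by linarith
  next
    fix r assume r: "0 \<le> r" "r \<le> T"
    have eq: "?\<phi> r = mu * (relax lam mu \<alpha> r - (x r + y r))" by (simp add: algebra_simps)
    show "?\<phi> r \<le> mu * (lam / mu)" unfolding eq
      using nonneg[OF r] relax_bounds[OF pos \<alpha> r(1)] pos by (intro mult_left_mono) auto
    show "\<delta> < ?d r \<Longrightarrow> ?\<phi> r \<le> 0" unfolding eq
      using pos \<delta> by (intro mult_nonneg_nonpos) auto
  next
    show "?d 0 \<le> \<delta>" using z0 by (simp add: relax_def)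
  qed (use t \<delta> in auto)
  then show ?thesis by simp
qed

lemma total_lower:
  assumes t: "0 \<le> t" "t \<le> T"
  shows "relax lam mu \<alpha> t - (x t + y t) \<le> 2 * \<delta>"
proof -
  let ?d = "\<lambda>t. relax lam mu \<alpha> t - (x t + y t)"
  let ?\<phi> = "\<lambda>r. (lam - mu * relax lam mu \<alpha> r) - (lam - mu * (x r + y r))"
  have "?d t \<le> \<delta> + \<delta>"
  proof (rule last_exit_bound[where d = ?d and \<phi> = ?\<phi> and B = "mu * (2 * \<delta>)" and T = T])
    show "?\<phi> integrable_on {0..T}"
      by (intro integrable_diff integrable_on_mult_right integrable_add integrable relax_integrable
          integrable_const_ivl)
    fix s t assume st: "0 \<le> s" "s \<le> t" "t \<le> T"
    have "integral {s..t} ?\<phi> = (relax lam mu \<alpha> t - relax lam mu \<alpha> s)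
        - integral {s..t} (\<lambda>r. lam - mu * (x r + y r))"
      using st integral_unique[OF relax_has_integral[OF pos(2) st(2)], of lam \<alpha>]
      by (subst integral_diff)
        (auto intro!: integrable_diff integrable_on_mult_right integrable_add integrable_sub[OF integrable(2)]
          integrable_sub[OF integrable(3)] relax_integrable)
    then show "?d t - ?d s \<le> integral {s..t} ?\<phi> + \<delta>" using z_inc[OF st] by linarith
  next
    fix r assume r: "0 \<le> r" "r \<le> T"
    have eq: "?\<phi> r = mu * ((x r + y r) - relax lam mu \<alpha> r)" by (simp add: algebra_simps)
    show "?\<phi> r \<le> mu * (2 * \<delta>)" unfolding eq
      using total_upper[OF r] pos by (intro mult_left_mono) auto
    show "\<delta> < ?d r \<Longrightarrow> ?\<phi> r \<le> 0" unfolding eq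
      using pos \<delta> by (intro mult_nonneg_nonpos) auto
  next
    show "?d 0 \<le> \<delta>" using z0 by (simp add: relax_def)
  qed (use t \<delta> in auto)
  then show ?thesis by simp
qed

lemma threshold_close:
  assumes "0 \<le> t" "t \<le> T"
  shows "\<bar>\<alpha> * (x t + y t) + \<eta> - threshold lam mu \<alpha> \<eta> t\<bar> \<le> 2 * \<delta>"
proof -
  have "\<alpha> * \<bar>x t + y t - relax lam mu \<alpha> t\<bar> \<le> 1 * (2 * \<delta>)"
    using total_upper[OF assms] total_lower[OF assms] \<alpha> by (intro mult_mono) auto
  moreover have "\<alpha> * (x t + y t) + \<eta> - threshold lam mu \<alpha> \<eta> t = \<alpha> * (x t + y t - relax lam mu \<alpha> t)"
    by (simp add: threshold_def algebra_simps)
  ultimately show ?thesis using \<alpha> by (simp add: abs_mult)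
qed

lemma upper_full:
  assumes t: "0 \<le> t" "t \<le> T"
  shows "x t - relax lam mu 1 t \<le> 2 * \<delta>"
proof -
  let ?d = "\<lambda>t. x t - relax lam mu 1 t"
  let ?\<phi> = "\<lambda>r. (lam * a r - mu * x r) - (lam - mu * relax lam mu 1 r)"
  have "?d t \<le> \<delta> + \<delta>"
  proof (rule last_exit_bound[where d = ?d and \<phi> = ?\<phi> and B = "mu * (lam / mu)" and T = T])
    show "?\<phi> integrable_on {0..T}"
      by (intro integrable_diff integrable_on_mult_right integrable relax_integrable
          integrable_const_ivl)
    fix s t assume st: "0 \<le> s" "s \<le> t" "t \<le> T"
    have "integral {s..t} ?\<phi> = integral {s..t} (\<lambda>r. lam * a r - mu * x r)
        - (relax lam mu 1 t - relax lam mu 1 s)"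
      using st integral_unique[OF relax_has_integral[OF pos(2) st(2)], of lam 1]
      by (subst integral_diff)
        (auto intro!: integrable_diff integrable_on_mult_right integrable_sub[OF integrable(2)]
          integrable_sub[OF integrable(1)] relax_integrable)
    then show "?d t - ?d s \<le> integral {s..t} ?\<phi> + \<delta>" using x_inc[OF st] by linarith
  next
    fix r assume r: "0 \<le> r" "r \<le> T"
    have "lam * a r \<le> lam" using a01[OF r] pos by (simp add: mult_left_le)
    then have le: "?\<phi> r \<le> mu * (relax lam mu 1 r - x r)" by (simp add: algebra_simps)
    have "mu * (relax lam mu 1 r - x r) \<le> mu * (lam / mu)"
      using nonneg[OF r] relax_bounds[OF pos _ _ r(1), of 1] pos by (intro mult_left_mono) auto
    then show "?\<phi> r \<le> mu * (lam / mu)" using le by linarith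
    show "?\<phi> r \<le> 0" if "\<delta> < ?d r"
    proof -
      have "mu * (relax lam mu 1 r - x r) \<le> 0" using pos \<delta> that by (intro mult_nonneg_nonpos) auto
      then show ?thesis using le by linarith
    qed
  next
    show "?d 0 \<le> \<delta>" using x0 by (simp add: relax_def)
  qed (use t \<delta> in auto)
  then show ?thesis by simp
qed

text \<open>Above the threshold every arrival is rejected, so \<open>x\<close> decreases there, while the threshold itself
  never decreases.\<close>

lemma upper_threshold:
  assumes t: "0 \<le> t" "t \<le> T"
  shows "x t - max 0 (threshold lam mu \<alpha> \<eta> t) \<le> 3 * \<delta>"
proof -
  let ?d = "\<lambda>t. x t - max 0 (threshold lam mu \<alpha> \<eta> t)"
  let ?\<phi> = "\<lambda>r. lam * a r - mu * x r"
  have "?d t \<le> 2 * \<delta> + \<delta>"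
  proof (rule last_exit_bound[where d = ?d and \<phi> = ?\<phi> and B = lam and T = T])
    show "?\<phi> integrable_on {0..T}"
      by (intro integrable_diff integrable_on_mult_right integrable)
    fix s t assume st: "0 \<le> s" "s \<le> t" "t \<le> T"
    have "threshold lam mu \<alpha> \<eta> s \<le> threshold lam mu \<alpha> \<eta> t"
      unfolding threshold_def using relax_mono[OF pos \<alpha>(1) st(2)] \<alpha> by (simp add: mult_left_mono)
    then show "?d t - ?d s \<le> integral {s..t} ?\<phi> + \<delta>" using x_inc[OF st] by linarith
  next
    fix r assume r: "0 \<le> r" "r \<le> T"
    have "lam * a r \<le> lam" "0 \<le> mu * x r" using a01[OF r] pos nonneg[OF r] by (simp_all add: mult_left_le)
    then show "?\<phi> r \<le> lam" by linarith
    show "?\<phi> r \<le> 0" if "2 * \<delta> < ?d r"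
    proof -
      have "a r = 0" using threshold_close[OF r] that by (intro reject[OF r]) linarith
      then show ?thesis using \<open>0 \<le> mu * x r\<close> by simp
    qed
  next
    show "?d 0 \<le> 2 * \<delta>" using x0 \<delta> by linarith
  qed (use t \<delta> in auto)
  then show ?thesis by simp
qed

lemma fluid_upper:
  assumes t: "0 \<le> t" "t \<le> T"
  shows "x t \<le> fluid lam mu \<alpha> \<eta> t + 3 * \<delta>"
  using upper_full[OF t] upper_threshold[OF t] relax_bounds(1)[OF pos _ _ t(1), of 1] \<delta>
  by (simp add: fluid_def)

text \<open>Below the smaller of the two branches \<open>x\<close> is below its threshold, so every arrival is accepted
  and \<open>x\<close> catches up with a path that grows no faster than full acceptance allows.\<close>

lemma fluid_lower:
  assumes accept: "\<And>r. 0 \<le> r \<Longrightarrow> r \<le> T \<Longrightarrow> x r < \<alpha> * (x r + y r) + \<eta> \<Longrightarrow> a r = 1"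
    and t: "0 \<le> t" "t \<le> T"
  shows "fluid lam mu \<alpha> \<eta> t \<le> x t + 3 * \<delta>"
proof -
  let ?m = "\<lambda>t. min (relax lam mu 1 t) (threshold lam mu \<alpha> \<eta> t)"
  let ?d = "\<lambda>t. ?m t - x t"
  let ?\<phi> = "\<lambda>r. (lam - mu * ?m r) - (lam * a r - mu * x r)"
  have m_int: "?m integrable_on {s..t}" for s t
    by (intro integrable_continuous_real continuous_on_min_relax_threshold)
  have x_le: "x r \<le> lam / mu + 2 * \<delta>" if "0 \<le> r" "r \<le> T" for r
    using upper_full[OF that] relax_bounds(2)[OF pos _ _ that(1), of 1] by simp
  define B where "B = lam + mu * \<bar>\<eta>\<bar> + mu * (lam / mu + 2 * \<delta>)"
  have "?d t \<le> 2 * \<delta> + \<delta>"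
  proof (rule last_exit_bound[where d = ?d and \<phi> = ?\<phi> and B = B and T = T])
    show "?\<phi> integrable_on {0..T}"
      by (intro integrable_diff integrable_on_mult_right integrable m_int integrable_const_ivl)
    fix s t assume st: "0 \<le> s" "s \<le> t" "t \<le> T"
    have "integral {s..t} ?\<phi> = integral {s..t} (\<lambda>r. lam - mu * ?m r)
        - integral {s..t} (\<lambda>r. lam * a r - mu * x r)"
      using st by (intro integral_diff integrable_diff integrable_on_mult_right integrable_sub[OF integrable(1)]
          integrable_sub[OF integrable(2)] m_int integrable_const_ivl)
    then show "?d t - ?d s \<le> integral {s..t} ?\<phi> + \<delta>"
      using x_inc[OF st] min_relax_threshold_le_integral[OF pos st(1,2) \<alpha>, of \<eta>] by linarith
  next
    fix r assume r: "0 \<le> r" "r \<le> T"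
    have "- \<bar>\<eta>\<bar> \<le> ?m r"
    proof -
      have "0 \<le> \<alpha> * relax lam mu \<alpha> r" using relax_bounds(1)[OF pos \<alpha> r(1)] \<alpha> by simp
      then show ?thesis using relax_bounds(1)[OF pos _ _ r(1), of 1] unfolding threshold_def by linarith
    qed
    then have "- (mu * ?m r) \<le> mu * \<bar>\<eta>\<bar>"
      using mult_left_mono[of "- \<bar>\<eta>\<bar>" "?m r" mu] pos by simp
    moreover have "mu * x r \<le> mu * (lam / mu + 2 * \<delta>)"
      using x_le[OF r] pos by (intro mult_left_mono) auto
    moreover have "0 \<le> lam * a r" using a01[OF r] pos by simp
    ultimately show "?\<phi> r \<le> B" unfolding B_def by linarith
    show "?\<phi> r \<le> 0" if "2 * \<delta> < ?d r"
    proof -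
      have "a r = 1" using threshold_close[OF r] that by (intro accept[OF r]) linarith
      then have "?\<phi> r = - (mu * ?d r)" by (simp add: algebra_simps)
      moreover have "0 \<le> mu * ?d r" using that \<delta> pos by (intro mult_nonneg_nonneg) auto
      ultimately show ?thesis by linarith
    qed
  next
    have "?m 0 \<le> 0" by (simp add: relax_def)
    moreover have "0 \<le> x 0" using nonneg(1)[of 0] t by auto
    ultimately show "?d 0 \<le> 2 * \<delta>" using \<delta> by linarith
  qed (use t \<delta> in auto)
  then show ?thesis using nonneg(1)[OF t] \<delta> by (simp add: fluid_def)
qed

end

section \<open>The penalty rule is a threshold rule\<close>

text \<open>The shift of the threshold that equates the two derivatives of \<open>Psi\<close>. For \<open>\<alpha> i \<in> {0, 1}\<close> it is
  zero, and the threshold rule is still the correct one.\<close>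

definition tilt :: "'i loss_model \<Rightarrow> real \<Rightarrow> ('i \<Rightarrow> real) \<Rightarrow> 'i \<Rightarrow> real" where
  "tilt L \<epsilon> \<alpha> i = (1 + 4 * \<epsilon>) * load L i / pen_beta \<epsilon> * (\<alpha> i * (1 - \<alpha> i) * ln (\<alpha> i / (1 - \<alpha> i)))"

lemma pen_beta_ge:
  assumes "0 < \<epsilon>" "\<epsilon> < 1/4"
  shows "0 < pen_beta \<epsilon>" "(1 + 4 * \<epsilon>) / pen_beta \<epsilon> \<le> \<epsilon>"
proof -
  \<comment> \<open>Here \<open>2 / \<epsilon> > 8\<close>, so its logarithm is at least 1.\<close>
  have "exp (1::real) \<le> 2 / \<epsilon>"
  proof -
    have "\<epsilon> * exp 1 \<le> 1/4 * 3" using exp_le assms by (intro mult_mono) auto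
    then show ?thesis using assms by (simp add: pos_le_divide_eq mult.commute)
  qed
  then have "1 \<le> ln (2 / \<epsilon>)"
    using ln_mono[of "exp 1" "2 / \<epsilon>"] assms by simp
  then have "2 / \<epsilon> * 1 \<le> 2 / \<epsilon> * ln (2 / \<epsilon>)"
    using assms by (intro mult_left_mono) auto
  then have ge: "2 / \<epsilon> \<le> pen_beta \<epsilon>" by (simp add: pen_beta_def)
  then show "0 < pen_beta \<epsilon>" using assms by (meson divide_pos_pos less_le_trans zero_less_numeral)
  have "2 \<le> \<epsilon> * pen_beta \<epsilon>" using ge assms by (simp add: field_simps)
  then show "(1 + 4 * \<epsilon>) / pen_beta \<epsilon> \<le> \<epsilon>"
    using \<open>0 < pen_beta \<epsilon>\<close> assms by (simp add: pos_divide_le_eq)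
qed

text \<open>Both follow from \<open>ln q \<le> q - 1\<close>, applied to the odds \<open>a / (1 - a)\<close> and to their reciprocal.\<close>

lemma entropy_bounds:
  fixes a :: real
  assumes "0 \<le> a" "a \<le> 1"
  shows "(1 - a) * ln (a / (1 - a)) \<le> 1" "\<bar>a * (1 - a) * ln (a / (1 - a))\<bar> \<le> 1"
proof -
  have "(1 - a) * ln (a / (1 - a)) \<le> 1 \<and> \<bar>a * (1 - a) * ln (a / (1 - a))\<bar> \<le> 1"
  proof (cases "a = 0 \<or> a = 1")
    case False
    then have a: "0 < a" "a < 1" using assms by auto
    have "ln (a / (1 - a)) \<le> a / (1 - a) - 1" using a by (intro ln_le_minus_one) simp
    then have "(1 - a) * ln (a / (1 - a)) \<le> (1 - a) * (a / (1 - a) - 1)"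
      using a by (intro mult_left_mono) auto
    also have "\<dots> = 2 * a - 1" using a by (simp add: field_simps)
    finally have 1: "(1 - a) * ln (a / (1 - a)) \<le> 2 * a - 1" .
    have "ln ((1 - a) / a) \<le> (1 - a) / a - 1" using a by (intro ln_le_minus_one) simp
    then have "a * ln ((1 - a) / a) \<le> a * ((1 - a) / a - 1)"
      using a by (intro mult_left_mono) auto
    also have "\<dots> = 1 - 2 * a" using a by (simp add: field_simps)
    finally have "a * ln ((1 - a) / a) \<le> 1 - 2 * a" .
    moreover have "ln ((1 - a) / a) = - ln (a / (1 - a))" using a by (simp add: ln_div)
    ultimately have 2: "2 * a - 1 \<le> a * ln (a / (1 - a))" by simp
    have "a * ((1 - a) * ln (a / (1 - a))) \<le> a * 1"
      using 1 a by (intro mult_left_mono) auto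
    then have 3: "a * ((1 - a) * ln (a / (1 - a))) \<le> 1" using a(2) by linarith
    have "(1 - a) * (- 1) \<le> (1 - a) * (a * ln (a / (1 - a)))"
      using 2 a by (intro mult_left_mono) auto
    moreover have "- 1 \<le> (1 - a) * (- 1)" using a by simp
    ultimately have "- 1 \<le> a * ((1 - a) * ln (a / (1 - a)))"
      by (subst mult.left_commute) (rule order_trans)
    then have "\<bar>a * ((1 - a) * ln (a / (1 - a)))\<bar> \<le> 1"
      using 3 by (intro abs_leI) linarith+
    then show ?thesis using 1 a by (simp add: mult.assoc)
  qed auto
  then show "(1 - a) * ln (a / (1 - a)) \<le> 1" "\<bar>a * (1 - a) * ln (a / (1 - a))\<bar> \<le> 1" by auto
qed

text \<open>The first, one-sided bound is relative to \<open>\<alpha> i\<close>; it is what the capacity estimate needs. The second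
  controls the loss of reward.\<close>

lemma tilt_bounds:
  assumes "0 < \<epsilon>" "\<epsilon> < 1/4" "0 \<le> load L i" "0 \<le> \<alpha> i" "\<alpha> i \<le> 1"
  shows "tilt L \<epsilon> \<alpha> i \<le> \<epsilon> * (load L i * \<alpha> i)" "\<bar>tilt L \<epsilon> \<alpha> i\<bar> \<le> \<epsilon> * load L i"
proof -
  let ?q = "(1 + 4 * \<epsilon>) / pen_beta \<epsilon>" and ?l = "ln (\<alpha> i / (1 - \<alpha> i))"
  have q: "0 \<le> ?q" "?q \<le> \<epsilon>" using pen_beta_ge[OF assms(1,2)] assms by auto
  have eq: "tilt L \<epsilon> \<alpha> i = ?q * load L i * (\<alpha> i * (1 - \<alpha> i) * ?l)" by (simp add: tilt_def)
  have "?q * load L i * \<alpha> i * ((1 - \<alpha> i) * ?l) \<le> ?q * load L i * \<alpha> i * 1"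
    using q assms entropy_bounds(1)[OF assms(4,5)] by (intro mult_left_mono mult_nonneg_nonneg)
  also have "\<dots> \<le> \<epsilon> * (load L i * \<alpha> i)"
    using q assms by (simp only: mult.assoc mult_1_right) (intro mult_right_mono; simp)
  finally show "tilt L \<epsilon> \<alpha> i \<le> \<epsilon> * (load L i * \<alpha> i)" unfolding eq by (simp only: mult.assoc)
  have "\<bar>tilt L \<epsilon> \<alpha> i\<bar> = ?q * load L i * \<bar>\<alpha> i * (1 - \<alpha> i) * ?l\<bar>"
    unfolding eq using q(1) assms(3) by (simp only: abs_mult[of "?q * load L i"] abs_of_nonneg mult_nonneg_nonneg)
  also have "\<dots> \<le> ?q * load L i * 1"
    using q assms entropy_bounds(2)[OF assms(4,5)] by (intro mult_left_mono mult_nonneg_nonneg)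
  also have "\<dots> \<le> \<epsilon> * load L i" using q assms by (simp only: mult_1_right) (intro mult_right_mono; simp)
  finally show "\<bar>tilt L \<epsilon> \<alpha> i\<bar> \<le> \<epsilon> * load L i" .
qed

lemma deriv_Psi:
  "deriv (\<lambda>z. Psi L \<epsilon> \<alpha> i z y) x
     = pen_beta \<epsilon> * req L i / pen_c0 L \<epsilon> \<alpha> i * exp (pen_beta \<epsilon> * req L i * x / pen_c0 L \<epsilon> \<alpha> i)"
  "deriv (\<lambda>z. Psi L \<epsilon> \<alpha> i x z) y
     = pen_beta \<epsilon> * req L i / pen_c1 L \<epsilon> \<alpha> i * exp (pen_beta \<epsilon> * req L i * y / pen_c1 L \<epsilon> \<alpha> i)"
  unfolding Psi_def
  by (rule DERIV_imp_deriv, auto intro!: derivative_eq_intros simp: divide_inverse)+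

text \<open>Taking logarithms makes the comparison of the derivatives linear in \<open>x\<close> and \<open>y\<close>.\<close>

lemma penalty_derivatives_le_iff:
  assumes "valid_model L" "0 < \<epsilon>" "\<epsilon> < 1/4" and a: "0 < \<alpha> i" "\<alpha> i < 1"
  shows "deriv (\<lambda>z. Psi L \<epsilon> \<alpha> i z y) x \<le> deriv (\<lambda>z. Psi L \<epsilon> \<alpha> i x z) y
    \<longleftrightarrow> x \<le> \<alpha> i * (x + y) + tilt L \<epsilon> \<alpha> i"
proof -
  define K where "K = pen_beta \<epsilon> / ((1 + 4 * \<epsilon>) * load L i)"
  define l where "l = ln (\<alpha> i / (1 - \<alpha> i))"
  have \<rho>: "load L i > 0" "req L i > 0" using assms(1) by (auto simp: valid_model_def load_def)
  have K: "K > 0" using pen_beta_ge[OF assms(2,3)] \<rho> assms by (simp add: K_def)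
  have c: "pen_beta \<epsilon> * req L i / pen_c0 L \<epsilon> \<alpha> i = K / \<alpha> i"
      "pen_beta \<epsilon> * req L i / pen_c1 L \<epsilon> \<alpha> i = K / (1 - \<alpha> i)"
    using \<rho> a assms by (simp_all add: K_def pen_c0_def pen_c1_def mult_ac)
  have c': "pen_beta \<epsilon> * req L i * x / pen_c0 L \<epsilon> \<alpha> i = K / \<alpha> i * x"
      "pen_beta \<epsilon> * req L i * y / pen_c1 L \<epsilon> \<alpha> i = K / (1 - \<alpha> i) * y"
    unfolding c[symmetric] by simp_all
  have el: "exp l = \<alpha> i / (1 - \<alpha> i)" using a by (simp add: l_def)
  have "deriv (\<lambda>z. Psi L \<epsilon> \<alpha> i z y) x \<le> deriv (\<lambda>z. Psi L \<epsilon> \<alpha> i x z) y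
      \<longleftrightarrow> K / \<alpha> i * exp (K / \<alpha> i * x) \<le> K / (1 - \<alpha> i) * exp (K / (1 - \<alpha> i) * y)"
    unfolding deriv_Psi c c' ..
  also have "\<dots> \<longleftrightarrow> exp (K / \<alpha> i * x) \<le> exp l * exp (K / (1 - \<alpha> i) * y)"
  proof -
    have "K / (1 - \<alpha> i) * q = K / \<alpha> i * (exp l * q)" for q unfolding el using a by simp
    then show ?thesis using a K by (simp only: mult_le_cancel_left_pos divide_pos_pos)
  qed
  also have "\<dots> \<longleftrightarrow> K / \<alpha> i * x \<le> l + K / (1 - \<alpha> i) * y"
    unfolding exp_add[symmetric] by simp
  also have "\<dots> \<longleftrightarrow> \<alpha> i * (1 - \<alpha> i) / K * (K / \<alpha> i * x) \<le> \<alpha> i * (1 - \<alpha> i) / K * (l + K / (1 - \<alpha> i) * y)"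
    using a K by (subst mult_le_cancel_left_pos) auto
  also have "\<alpha> i * (1 - \<alpha> i) / K * (K / \<alpha> i * x) = (1 - \<alpha> i) * x" using a K by simp
  also have "\<alpha> i * (1 - \<alpha> i) / K * (l + K / (1 - \<alpha> i) * y) = \<alpha> i * (1 - \<alpha> i) * l / K + \<alpha> i * y"
    using a K by (simp add: distrib_left)
  also have "\<alpha> i * (1 - \<alpha> i) * l / K = tilt L \<epsilon> \<alpha> i" by (simp add: tilt_def K_def l_def)
  finally show ?thesis by (simp add: algebra_simps)
qed

text \<open>The inequality is strict in the second part: for \<open>\<alpha> i = 0\<close> the threshold is zero and nothing is
  accepted at \<open>x i = 0\<close>. For \<open>\<alpha> i = 1\<close> the threshold is \<open>x i + y i\<close>, which \<open>x i\<close> never exceeds.\<close>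

lemma accepts_below_threshold:
  assumes "valid_model L" "0 < \<epsilon>" "\<epsilon> < 1/4" and a: "0 \<le> \<alpha> i" "\<alpha> i \<le> 1"
    and xy: "0 \<le> x i" "0 \<le> y i"
  shows "accepts L \<epsilon> \<alpha> n i x y \<Longrightarrow> x i \<le> \<alpha> i * (x i + y i) + tilt L \<epsilon> \<alpha> i"
    and "x i < \<alpha> i * (x i + y i) + tilt L \<epsilon> \<alpha> i \<Longrightarrow>
      (\<Sum>j\<in>UNIV. req L j * x j) + req L i / real n \<le> cap L \<Longrightarrow> accepts L \<epsilon> \<alpha> n i x y"
proof -
  have pos: "load L i > 0" "req L i > 0" using assms(1) by (auto simp: valid_model_def load_def)
  have c: "pen_c0 L \<epsilon> \<alpha> i = 0 \<longleftrightarrow> \<alpha> i = 0" "pen_c1 L \<epsilon> \<alpha> i = 0 \<longleftrightarrow> \<alpha> i = 1"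
    using pos assms(2) by (auto simp: pen_c0_def pen_c1_def)
  consider "\<alpha> i = 0" | "\<alpha> i = 1" | "0 < \<alpha> i" "\<alpha> i < 1" using a by linarith
  then have "(accepts L \<epsilon> \<alpha> n i x y \<longrightarrow> x i \<le> \<alpha> i * (x i + y i) + tilt L \<epsilon> \<alpha> i) \<and>
     (x i < \<alpha> i * (x i + y i) + tilt L \<epsilon> \<alpha> i \<longrightarrow>
      (\<Sum>j\<in>UNIV. req L j * x j) + req L i / real n \<le> cap L \<longrightarrow> accepts L \<epsilon> \<alpha> n i x y)"
  proof cases
    case 1
    then show ?thesis using xy by (simp add: accepts_def c tilt_def)
  next
    case 2
    then show ?thesis using xy by (simp add: accepts_def c tilt_def)
  next
    case 3
    then show ?thesis
      using penalty_derivatives_le_iff[OF assms(1-3), where \<alpha> = \<alpha> and i = i, OF 3, of "y i" "x i"]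
      by (auto simp: accepts_def c)
  qed
  then show "accepts L \<epsilon> \<alpha> n i x y \<Longrightarrow> x i \<le> \<alpha> i * (x i + y i) + tilt L \<epsilon> \<alpha> i"
    and "x i < \<alpha> i * (x i + y i) + tilt L \<epsilon> \<alpha> i \<Longrightarrow>
      (\<Sum>j\<in>UNIV. req L j * x j) + req L i / real n \<le> cap L \<Longrightarrow> accepts L \<epsilon> \<alpha> n i x y" by auto
qed

lemma fluid_le:
  assumes L: "valid_model L" and e: "0 < \<epsilon>" "\<epsilon> < 1/4" and a: "0 \<le> \<alpha> i" "\<alpha> i \<le> 1" and t: "0 \<le> t"
  shows "fluid (arr L i) (srv L i) (\<alpha> i) (tilt L \<epsilon> \<alpha> i) t \<le> (1 + \<epsilon>) * (load L i * \<alpha> i)"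
proof -
  have p: "0 < arr L i" "0 < srv L i" using L by (auto simp: valid_model_def)
  have l: "0 \<le> load L i" using p by (simp add: load_def)
  have "\<alpha> i * relax (arr L i) (srv L i) (\<alpha> i) t \<le> \<alpha> i * load L i"
    using relax_bounds(2)[OF p a t] a unfolding load_def by (intro mult_left_mono)
  then have "threshold (arr L i) (srv L i) (\<alpha> i) (tilt L \<epsilon> \<alpha> i) t \<le> (1 + \<epsilon>) * (load L i * \<alpha> i)"
    using tilt_bounds(1)[of \<epsilon> L i \<alpha>, OF e l a] by (simp add: threshold_def distrib_right mult.commute)
  moreover have "0 \<le> (1 + \<epsilon>) * (load L i * \<alpha> i)" using e l a by simp
  ultimately show ?thesis by (auto simp: fluid_def)
qed

lemma fluid_ge:
  assumes L: "valid_model L" and e: "0 < \<epsilon>" "\<epsilon> < 1/4" and a: "0 \<le> \<alpha> i" "\<alpha> i \<le> 1" and t: "0 \<le> t"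
  shows "load L i * \<alpha> i * (1 - exp (- srv L i * t)) - \<epsilon> * load L i
    \<le> fluid (arr L i) (srv L i) (\<alpha> i) (tilt L \<epsilon> \<alpha> i) t"
proof -
  have p: "0 < arr L i" "0 < srv L i" using L by (auto simp: valid_model_def)
  have l: "0 \<le> load L i" using p by (simp add: load_def)
  let ?w = "exp (- srv L i * t)"
  have w: "?w \<le> 1" using p t by simp
  have "\<alpha> i * (1 - ?w) \<le> 1 - ?w" using a w by (intro mult_left_le_one_le) auto
  then have 1: "load L i * \<alpha> i * (1 - ?w) \<le> relax (arr L i) (srv L i) 1 t"
    using l unfolding relax_def load_def[symmetric] mult.assoc by (intro mult_left_mono) auto
  have "\<alpha> i * ?w \<le> ?w" using a by (intro mult_left_le_one_le) auto
  then have "load L i * \<alpha> i * (1 - ?w) \<le> load L i * \<alpha> i * (1 - \<alpha> i * ?w)"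
    using l a by (intro mult_left_mono) auto
  then have "load L i * \<alpha> i * (1 - ?w) - \<epsilon> * load L i \<le> threshold (arr L i) (srv L i) (\<alpha> i) (tilt L \<epsilon> \<alpha> i) t"
    using tilt_bounds(2)[of \<epsilon> L i \<alpha>, OF e l a]
    unfolding threshold_def relax_def load_def[symmetric] by (simp add: mult_ac)
  then show ?thesis using 1 e l unfolding fluid_def by (smt (verit) mult_nonneg_nonneg)
qed

text \<open>Together with \<open>fluid_le\<close>: the fluid paths of all classes never use the whole capacity, since
  \<open>1 + \<epsilon> < 1 + 4 \<epsilon>\<close>.\<close>

lemma fluid_capacity_slack:
  assumes L: "valid_model L" and e: "0 < \<epsilon>" "\<epsilon> < 1/4" and f: "primal_feasible (shrunk \<epsilon> L) \<alpha>"
  shows "(1 + \<epsilon>) * (\<Sum>j\<in>UNIV. req L j * load L j * \<alpha> j) < cap L"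
proof -
  have "(\<Sum>j\<in>UNIV. req L j * load L j * \<alpha> j) \<le> cap L / (1 + 4 * \<epsilon>)"
    using f by (simp add: primal_feasible_def shrunk_def load_def)
  then have "(1 + \<epsilon>) * (\<Sum>j\<in>UNIV. req L j * load L j * \<alpha> j) \<le> (1 + \<epsilon>) * (cap L / (1 + 4 * \<epsilon>))"
    using e by (intro mult_left_mono) auto
  also have "\<dots> < cap L" using e L by (simp add: valid_model_def field_simps)
  finally show ?thesis .
qed

section \<open>The fluid limit\<close>

text \<open>The counterparts of \<open>normalized\<close> and \<open>penalty_system\<close> for one fixed sample path.\<close>

definition state :: "nat \<Rightarrow> ('i \<Rightarrow> real \<Rightarrow> nat) \<Rightarrow> real \<Rightarrow> 'i \<Rightarrow> real" where
  "state n X s = (\<lambda>j. real (X j s) / real n)"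

definition time_change_equations ::
    "(clock \<Rightarrow> ('i::finite) \<Rightarrow> real \<Rightarrow> nat) \<Rightarrow> 'i loss_model \<Rightarrow> real \<Rightarrow> ('i \<Rightarrow> real) \<Rightarrow> nat \<Rightarrow>
     ('i \<Rightarrow> nat) \<Rightarrow> ('i \<Rightarrow> real \<Rightarrow> nat) \<Rightarrow> ('i \<Rightarrow> real \<Rightarrow> nat) \<Rightarrow> bool" where
  "time_change_equations P L \<epsilon> \<alpha> n y0 X Y \<longleftrightarrow> (\<forall>i. \<forall>t\<ge>0.
     (\<lambda>s. nu_x L \<epsilon> \<alpha> n i (state n X s) (state n Y s)) integrable_on {0..t} \<and>
     (\<lambda>s. kappa L n i (state n X s)) integrable_on {0..t} \<and>
     (\<lambda>s. kappa L n i (state n Y s)) integrable_on {0..t} \<and>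
     real (X i t) = real (P Ax i (integral {0..t} (\<lambda>s. nu_x L \<epsilon> \<alpha> n i (state n X s) (state n Y s))))
       - real (P Dx i (integral {0..t} (\<lambda>s. kappa L n i (state n X s)))) \<and>
     real (Y i t) = real (y0 i)
       + real (P Ay i (integral {0..t} (\<lambda>s. nu_y L \<epsilon> \<alpha> n i (state n X s) (state n Y s))))
       - real (P Dy i (integral {0..t} (\<lambda>s. kappa L n i (state n Y s)))))"

text \<open>Up to time \<open>T\<close> no clock of class \<open>i\<close> is read beyond \<open>n\<close> times this value: the arrival clocks run
  at rate at most \<open>n * arr L i\<close>, and each population stays below \<open>n * (load L i + arr L i * T + 2)\<close>, namely the
  initial load, the arrivals, and 2 for rounding and for the error of the arrival clock.\<close>

definition clock_horizon :: "'i loss_model \<Rightarrow> real \<Rightarrow> 'i \<Rightarrow> real" where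
  "clock_horizon L T i = arr L i * T + srv L i * (load L i + arr L i * T + 2) * T"

definition clocks_close :: "(clock \<Rightarrow> 'i \<Rightarrow> real \<Rightarrow> nat) \<Rightarrow> 'i loss_model \<Rightarrow> nat \<Rightarrow> real \<Rightarrow> real \<Rightarrow> bool" where
  "clocks_close P L n T \<eta> \<longleftrightarrow> (\<forall>k i a. 0 \<le> a \<and> a \<le> real n * clock_horizon L T i \<longrightarrow>
     \<bar>real (P k i a) - a\<bar> \<le> \<eta> * real n)"

lemma eventually_clocks_close:
  fixes L :: "('i::finite) loss_model"
  assumes L: "valid_model L" and P: "\<And>k i. sublinear_error (P k i)" and "0 < \<eta>" "0 \<le> T"
  shows "\<forall>\<^sub>F n in sequentially. clocks_close P L n T \<eta>"
proof -
  have fin: "finite (UNIV :: clock set)"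
  proof -
    have "(UNIV :: clock set) \<subseteq> {Ax, Ay, Dx, Dy}" using clock.exhaust by auto
    then show ?thesis by (rule finite_subset) simp
  qed
  have K: "0 \<le> clock_horizon L T i" for i
    using L \<open>0 \<le> T\<close> by (auto simp: clock_horizon_def valid_model_def load_def less_imp_le
        intro!: add_nonneg_nonneg mult_nonneg_nonneg)
  have "\<forall>\<^sub>F n in sequentially. \<forall>(k, i)\<in>UNIV. \<forall>a. 0 \<le> a \<and> a \<le> real n * clock_horizon L T i \<longrightarrow>
     \<bar>real (P k i a) - a\<bar> \<le> \<eta> * real n"
    using sublinear_error_scaled[OF P \<open>0 < \<eta>\<close> K] fin
    by (intro eventually_ball_finite) (auto simp: finite_prod)
  then show ?thesis by (simp add: clocks_close_def)
qed

text \<open>An increment of the total of both systems involves the four clocks of the class at two times, hence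
  eight clock errors; this explains \<open>\<delta> / 8\<close>. The departure clocks can only be controlled after the
  populations have been bounded by their arrivals alone.\<close>

lemma system_near_fluid_class:
  fixes L :: "('i::finite) loss_model"
  assumes L: "valid_model L" and e: "0 < \<epsilon>" "\<epsilon> < 1/4" and a: "0 \<le> \<alpha> i" "\<alpha> i \<le> 1"
    and n: "1 \<le> n" "1 / real n \<le> \<delta> / 2" and \<delta>: "0 < \<delta>" "\<delta> \<le> 1" and T: "0 \<le> T"
    and eqs: "time_change_equations P L \<epsilon> \<alpha> n y0 X Y"
    and y0: "initial_load L \<alpha> n y0"
    and close: "clocks_close P L n T (\<delta> / 8)"
  shows "near_fluid_class (arr L i) (srv L i) (\<alpha> i) (tilt L \<epsilon> \<alpha> i) T \<delta>
    (\<lambda>s. state n X s i) (\<lambda>s. state n Y s i)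
    (\<lambda>s. nu_x L \<epsilon> \<alpha> n i (state n X s) (state n Y s) / (real n * arr L i))"
proof -
  let ?lam = "arr L i" and ?mu = "srv L i"
  let ?nx = "\<lambda>s. nu_x L \<epsilon> \<alpha> n i (state n X s) (state n Y s)"
  let ?ny = "\<lambda>s. nu_y L \<epsilon> \<alpha> n i (state n X s) (state n Y s)"
  let ?kx = "\<lambda>s. kappa L n i (state n X s)" and ?ky = "\<lambda>s. kappa L n i (state n Y s)"
  let ?N = "real n"
  define F where "F t = integral {0..t} ?nx" for t
  define F' where "F' t = integral {0..t} ?ny" for t
  define G where "G t = integral {0..t} ?kx" for t
  define H where "H t = integral {0..t} ?ky" for t
  have pos: "0 < ?lam" "0 < ?mu" using L by (auto simp: valid_model_def)
  have l: "0 < load L i" using pos by (simp add: load_def)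
  have N: "0 < ?N" using n by simp
  have eq: "?nx integrable_on {0..t}" "?kx integrable_on {0..t}" "?ky integrable_on {0..t}"
      "real (X i t) = real (P Ax i (F t)) - real (P Dx i (G t))"
      "real (Y i t) = real (y0 i) + real (P Ay i (F' t)) - real (P Dy i (H t))" if "0 \<le> t" for t
    using eqs that unfolding time_change_equations_def F_def G_def H_def F'_def by blast+
  have nx: "0 \<le> ?nx s" "?nx s \<le> ?N * ?lam" for s
    using pos by (auto simp: nu_x_def)
  have ny_eq: "?ny = (\<lambda>s. ?N * ?lam - ?nx s)" by (simp add: nu_y_def)
  have F: "0 \<le> F t" "F t \<le> ?N * (?lam * t)" "F' t = ?N * (?lam * t) - F t" if "0 \<le> t" for t
  proof -
    show "0 \<le> F t" unfolding F_def using eq(1)[OF that] nx by (intro integral_nonneg) auto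
    have "F t \<le> integral {0..t} (\<lambda>_. ?N * ?lam)"
      unfolding F_def using eq(1)[OF that] nx by (intro integral_le) auto
    then show "F t \<le> ?N * (?lam * t)" using that by (simp add: mult_ac)
    show "F' t = ?N * (?lam * t) - F t"
      unfolding F'_def ny_eq F_def using eq(1)[OF that] that by (subst integral_diff) (auto simp: mult_ac)
  qed
  have clk: "\<bar>real (P k i b) - b\<bar> \<le> \<delta> / 8 * ?N" if "0 \<le> b" "b \<le> ?N * clock_horizon L T i" for k b
    using close that unfolding clocks_close_def by blast
  have lamT: "?lam * t \<le> ?lam * T" if "t \<le> T" for t using that pos by simp
  have hor: "?lam * T \<le> clock_horizon L T i"
    using pos l T by (simp add: clock_horizon_def less_imp_le)
  have mono_hor: "b \<le> ?N * clock_horizon L T i" if "b \<le> ?N * (?lam * t)" "t \<le> T" for b t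
  proof -
    have "?lam * t \<le> clock_horizon L T i" using lamT[OF that(2)] hor by linarith
    then have "?N * (?lam * t) \<le> ?N * clock_horizon L T i" by (intro mult_left_mono) auto
    then show ?thesis using that by linarith
  qed
  have Fclk: "\<bar>real (P Ax i (F t)) - F t\<bar> \<le> \<delta> / 8 * ?N" if "0 \<le> t" "t \<le> T" for t
    using F[OF that(1)] mono_hor[OF _ that(2)] by (intro clk) auto
  have F'clk: "\<bar>real (P Ay i (F' t)) - F' t\<bar> \<le> \<delta> / 8 * ?N" if "0 \<le> t" "t \<le> T" for t
    using F[OF that(1)] by (intro clk mono_hor[OF _ that(2)]) auto
  have y0': "\<bar>real (y0 i) - ?N * ((1 - \<alpha> i) * load L i)\<bar> < 1"
    using y0 by (simp add: initial_load_def scaled_def load_def mult_ac)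
  have "\<delta> / 8 * ?N \<le> 1 * ?N" using \<delta> by (intro mult_right_mono) auto
  then have d1: "\<delta> / 8 * ?N \<le> ?N" by simp
  have n1: "1 \<le> \<delta> / 2 * ?N" using n(2) N by (simp add: field_simps)
  have NT: "?N * (?lam * t) \<le> ?N * (?lam * T)" if "t \<le> T" for t
    by (rule mult_left_mono[OF lamT[OF that]]) simp
  let ?C = "load L i + ?lam * T + 2"
  have C: "0 \<le> ?C" using l pos T by (simp add: add_nonneg_nonneg less_imp_le)
  have Xb: "real (X i t) \<le> ?N * ?C" if "0 \<le> t" "t \<le> T" for t
  proof -
    have "0 \<le> ?N * load L i" using l by simp
    then show ?thesis
      using eq(4)[OF that(1)] Fclk[OF that] F(2)[OF that(1)] d1 NT[OF that(2)] N
      by (simp only: distrib_left abs_le_iff) linarith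
  qed
  have Yb: "real (Y i t) \<le> ?N * ?C" if "0 \<le> t" "t \<le> T" for t
  proof -
    have "(1 - \<alpha> i) * load L i \<le> load L i" using a l by (intro mult_left_le_one_le) auto
    then have "?N * ((1 - \<alpha> i) * load L i) \<le> ?N * load L i" by (intro mult_left_mono) auto
    then show ?thesis
      using eq(5)[OF that(1)] F'clk[OF that] F(1,3)[OF that(1)] d1 NT[OF that(2)] N n(1) y0'
      by (simp only: distrib_left abs_le_iff abs_less_iff) linarith
  qed
  have kap: "?kx s = ?mu * real (X i s)" "?ky s = ?mu * real (Y i s)" for s
    using N by (simp_all add: kappa_def state_def)
  have int_hor: "?mu * (?N * ?C) * t \<le> ?N * clock_horizon L T i" if "0 \<le> t" "t \<le> T" for t
  proof -
    have "?mu * (?N * ?C) * t \<le> ?mu * (?N * ?C) * T"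
      using that pos C by (intro mult_left_mono) auto
    also have "\<dots> = ?N * (?mu * ?C * T)" by (simp only: mult_ac)
    also have "\<dots> \<le> ?N * clock_horizon L T i"
      using pos T unfolding clock_horizon_def by (intro mult_left_mono) auto
    finally show ?thesis .
  qed
  have G: "0 \<le> G t" "G t \<le> ?N * clock_horizon L T i" if "0 \<le> t" "t \<le> T" for t
  proof -
    show "0 \<le> G t" unfolding G_def using eq(2)[OF that(1)] pos
      by (intro integral_nonneg) (auto simp: kap)
    have "G t \<le> integral {0..t} (\<lambda>_. ?mu * (?N * ?C))"
      unfolding G_def using eq(2)[OF that(1)] pos Xb that
      by (intro integral_le) (auto simp: kap intro!: mult_left_mono)
    then show "G t \<le> ?N * clock_horizon L T i" using int_hor[OF that] that by (simp add: mult_ac)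
  qed
  have H: "0 \<le> H t" "H t \<le> ?N * clock_horizon L T i" if "0 \<le> t" "t \<le> T" for t
  proof -
    show "0 \<le> H t" unfolding H_def using eq(3)[OF that(1)] pos
      by (intro integral_nonneg) (auto simp: kap)
    have "H t \<le> integral {0..t} (\<lambda>_. ?mu * (?N * ?C))"
      unfolding H_def using eq(3)[OF that(1)] pos Yb that
      by (intro integral_le) (auto simp: kap intro!: mult_left_mono)
    then show "H t \<le> ?N * clock_horizon L T i" using int_hor[OF that] that by (simp add: mult_ac)
  qed
  have Gclk: "\<bar>real (P Dx i (G t)) - G t\<bar> \<le> \<delta> / 8 * ?N" if "0 \<le> t" "t \<le> T" for t
    using G[OF that] by (intro clk)
  have Hclk: "\<bar>real (P Dy i (H t)) - H t\<bar> \<le> \<delta> / 8 * ?N" if "0 \<le> t" "t \<le> T" for t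
    using H[OF that] by (intro clk)
  have Xerr: "\<bar>real (X i t) - (F t - G t)\<bar> \<le> \<delta> / 4 * ?N" if "0 \<le> t" "t \<le> T" for t
    using eq(4)[OF that(1)] Fclk[OF that] Gclk[OF that] by linarith
  have Zerr: "\<bar>real (X i t) + real (Y i t) - (real (y0 i) + ?N * (?lam * t) - G t - H t)\<bar> \<le> \<delta> / 2 * ?N"
    if "0 \<le> t" "t \<le> T" for t
    using eq(4,5)[OF that(1)] Fclk[OF that] Gclk[OF that] F'clk[OF that] Hclk[OF that] F(3)[OF that(1)]
    by linarith
  have at0: "F 0 = 0" "G 0 = 0" "H 0 = 0" by (simp_all add: F_def G_def H_def)
  have combine: "integral {s..t} f = integral {0..t} f - integral {0..s} f"
    if "f integrable_on {0..t}" "0 \<le> s" "s \<le> t" for f :: "real \<Rightarrow> real" and s t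
    using Henstock_Kurzweil_Integration.integral_combine[OF that(2,3,1)] by simp
  have scale: "\<bar>p / ?N - q / ?N - I\<bar> \<le> \<delta>" if "\<bar>p - q - ?N * I\<bar> \<le> \<delta> * ?N" for p q I
  proof -
    have "p / ?N - q / ?N - I = (p - q - ?N * I) / ?N" using N by (simp add: field_simps)
    then show ?thesis using that N by (simp add: abs_divide pos_divide_le_eq)
  qed
  have x_int: "(\<lambda>s. state n X s i) integrable_on {0..t}" "(\<lambda>s. state n Y s i) integrable_on {0..t}"
    if "0 \<le> t" for t
    using integrable_on_mult_right[OF eq(2)[OF that], of "1 / (?N * ?mu)"]
      integrable_on_mult_right[OF eq(3)[OF that], of "1 / (?N * ?mu)"] pos N
    by (simp_all add: kappa_def)
  let ?a = "\<lambda>s. ?nx s / (?N * ?lam)"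
  have a_int: "?a integrable_on {0..t}" if "0 \<le> t" for t
    using integrable_on_mult_right[OF eq(1)[OF that], of "1 / (?N * ?lam)"] by simp
  show ?thesis
  proof
    show "0 < ?lam" "0 < ?mu" "0 \<le> \<alpha> i" "\<alpha> i \<le> 1" "0 \<le> \<delta>" using pos a \<delta> by auto
    show "0 \<le> state n X r i" "0 \<le> state n Y r i" for r by (simp_all add: state_def)
    show "?a integrable_on {0..T}" "(\<lambda>s. state n X s i) integrable_on {0..T}"
      "(\<lambda>s. state n Y s i) integrable_on {0..T}"
      using x_int a_int T by auto
    show "0 \<le> ?a r" "?a r \<le> 1" for r using nx[of r] pos N by (auto simp: pos_divide_le_eq)
  next
    fix s t :: real assume st: "0 \<le> s" "s \<le> t" "t \<le> T"
    have t: "0 \<le> t" and s: "s \<le> T" using st by auto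
    have ni: "integral {0..q} ?nx - integral {0..q} ?kx
        = ?N * integral {0..q} (\<lambda>r. ?lam * ?a r - ?mu * state n X r i)" if "0 \<le> q" for q
    proof -
      have "(\<lambda>r. ?N * (?lam * ?a r - ?mu * state n X r i)) = (\<lambda>r. ?nx r - ?kx r)"
        using N pos by (auto simp: kappa_def field_simps)
      then show ?thesis using integral_diff[OF eq(1,2)[OF that]] by (simp flip: integral_mult_right)
    qed
    have "?N * integral {s..t} (\<lambda>r. ?lam * ?a r - ?mu * state n X r i) = (F t - G t) - (F s - G s)"
    proof -
      have "(\<lambda>r. ?lam * ?a r - ?mu * state n X r i) integrable_on {0..t}"
        by (intro integrable_diff integrable_on_mult_right a_int x_int t)
      from combine[OF this st(1,2)] show ?thesis
        using ni[OF t] ni[OF st(1)] by (simp add: F_def G_def right_diff_distrib)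
    qed
    then show "\<bar>state n X t i - state n X s i - integral {s..t} (\<lambda>r. ?lam * ?a r - ?mu * state n X r i)\<bar> \<le> \<delta>"
      using Xerr[OF t st(3)] Xerr[OF st(1) s] \<delta> N unfolding state_def by (intro scale) linarith
    have nz: "?N * (?lam * q) - G q - H q
        = ?N * integral {0..q} (\<lambda>r. ?lam - ?mu * (state n X r i + state n Y r i))" if "0 \<le> q" for q
    proof -
      have "(\<lambda>r. ?N * (?lam - ?mu * (state n X r i + state n Y r i))) = (\<lambda>r. (?N * ?lam - ?kx r) - ?ky r)"
        by (auto simp: kappa_def algebra_simps)
      moreover have "integral {0..q} (\<lambda>r. (?N * ?lam - ?kx r) - ?ky r) = ?N * (?lam * q) - G q - H q"
        unfolding G_def H_def using eq(2,3)[OF that] that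
        by (simp add: integral_diff[OF integrable_diff[OF integrable_const_ivl eq(2)[OF that]] eq(3)[OF that]]
            integral_diff[OF integrable_const_ivl eq(2)[OF that]] mult_ac)
      ultimately show ?thesis by (simp flip: integral_mult_right)
    qed
    have "?N * integral {s..t} (\<lambda>r. ?lam - ?mu * (state n X r i + state n Y r i))
        = (?N * (?lam * t) - G t - H t) - (?N * (?lam * s) - G s - H s)"
    proof -
      have "(\<lambda>r. ?lam - ?mu * (state n X r i + state n Y r i)) integrable_on {0..t}"
        by (intro integrable_diff integrable_on_mult_right integrable_add x_int t integrable_const_ivl)
      from combine[OF this st(1,2)] show ?thesis
        using nz[OF t] nz[OF st(1)] by (simp add: right_diff_distrib)
    qed
    then show "\<bar>(state n X t i + state n Y t i) - (state n X s i + state n Y s i)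
        - integral {s..t} (\<lambda>r. ?lam - ?mu * (state n X r i + state n Y r i))\<bar> \<le> \<delta>"
      using Zerr[OF t st(3)] Zerr[OF st(1) s]
      unfolding state_def add_divide_distrib[symmetric] by (intro scale) linarith
  next
    have "real (X i 0) \<le> \<delta> * ?N" using Xerr[of 0] T at0 \<delta> N by linarith
    then show "state n X 0 i \<le> \<delta>" using N by (simp add: state_def pos_divide_le_eq)
    have "\<bar>real (X i 0) + real (Y i 0) - ?N * ((1 - \<alpha> i) * load L i)\<bar> \<le> \<delta> * ?N"
    proof -
      have tri: "\<bar>p - m\<bar> \<le> d + d" if "\<bar>p - q\<bar> \<le> d" "\<bar>q - m\<bar> < 1" "1 \<le> d" for p q m d :: real
        using that by linarith
      have "\<bar>real (X i 0) + real (Y i 0) - real (y0 i)\<bar> \<le> \<delta> / 2 * ?N"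
        using Zerr[of 0] T at0 by simp
      from tri[OF this y0' n1] show ?thesis by simp
    qed
    then show "\<bar>state n X 0 i + state n Y 0 i - ?lam / ?mu * (1 - \<alpha> i)\<bar> \<le> \<delta>"
      using scale[of "real (X i 0) + real (Y i 0)" 0 "(1 - \<alpha> i) * load L i"]
      by (simp add: state_def load_def add_divide_distrib mult.commute)
  next
    fix r assume "\<alpha> i * (state n X r i + state n Y r i) + tilt L \<epsilon> \<alpha> i < state n X r i"
    then have "\<not> accepts L \<epsilon> \<alpha> n i (state n X r) (state n Y r)"
      using accepts_below_threshold(1)[where \<alpha> = \<alpha> and i = i and x = "state n X r" and y = "state n Y r", OF L e a, of n]
      by (auto simp: state_def)
    then show "?a r = 0" by (simp add: nu_x_def)
  qed
qed

text \<open>The upper bounds of all classes keep the used capacity away from \<open>cap L\<close> by half of the slack, which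
  leaves room for one more request of size \<open>req L i / n\<close>. So the capacity test is void, and the lower bound
  becomes available.\<close>

lemma fluid_limit:
  fixes L :: "('i::finite) loss_model"
  assumes L: "valid_model L" and e: "0 < \<epsilon>" "\<epsilon> < 1/4" and f: "primal_feasible (shrunk \<epsilon> L) \<alpha>"
    and P: "\<And>k i. sublinear_error (P k i)"
    and eqs: "\<And>n. 1 \<le> n \<Longrightarrow> time_change_equations P L \<epsilon> \<alpha> n (y0 n) (X n) (Y n)"
    and y0: "\<And>n. 1 \<le> n \<Longrightarrow> initial_load L \<alpha> n (y0 n)"
    and T: "0 \<le> T"
  shows "(\<lambda>n. state n (X n) T i) \<longlonglongrightarrow> fluid (arr L i) (srv L i) (\<alpha> i) (tilt L \<epsilon> \<alpha> i) T"
proof (rule tendstoI)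
  fix \<gamma> :: real assume "0 < \<gamma>"
  let ?fl = "\<lambda>j. fluid (arr L j) (srv L j) (\<alpha> j) (tilt L \<epsilon> \<alpha> j)"
  have a: "0 \<le> \<alpha> j" "\<alpha> j \<le> 1" for j using f by (auto simp: primal_feasible_def)
  have b: "0 < req L j" for j using L by (auto simp: valid_model_def)
  define gap where "gap = cap L - (1 + \<epsilon>) * (\<Sum>j\<in>UNIV. req L j * load L j * \<alpha> j)"
  have gap: "0 < gap" using fluid_capacity_slack[OF L e f] by (simp add: gap_def)
  have gap_eq: "(1 + \<epsilon>) * (\<Sum>j\<in>UNIV. req L j * load L j * \<alpha> j) = cap L - gap" by (simp add: gap_def)
  define S where "S = (\<Sum>j\<in>UNIV. req L j)"
  have S: "0 \<le> S" unfolding S_def by (rule sum_nonneg[OF less_imp_le[OF b]])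
  \<comment> \<open>Small enough for the target precision and for \<open>3 \<delta>\<close> per class to use at most half of the slack.\<close>
  define \<delta> where "\<delta> = min (min 1 (\<gamma> / 4)) (gap / (6 * (S + 1)))"
  have \<delta>: "0 < \<delta>" "\<delta> \<le> 1" "3 * \<delta> < \<gamma>" using \<open>0 < \<gamma>\<close> gap S by (auto simp: \<delta>_def)
  have "\<delta> * (6 * (S + 1)) \<le> gap"
    using S by (subst pos_le_divide_eq[symmetric]) (auto simp: \<delta>_def)
  then have slack: "3 * \<delta> * S \<le> gap / 2" using \<delta> by (simp add: algebra_simps)
  have "\<forall>\<^sub>F n in sequentially. max (2 / \<delta>) (2 * S / gap) \<le> real n"
    using filterlim_real_sequentially unfolding filterlim_at_top by blast
  moreover have "\<forall>\<^sub>F n in sequentially. clocks_close P L n T (\<delta> / 8)"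
    using eventually_clocks_close[OF L P _ T, of "\<delta> / 8"] \<delta> by simp
  ultimately show "\<forall>\<^sub>F n in sequentially. dist (state n (X n) T i) (?fl i T) < \<gamma>"
    using eventually_ge_at_top[of 1]
  proof eventually_elim
    case (elim n)
    then have N: "0 < real n" by simp
    have "2 / \<delta> \<le> real n" "2 * S / gap \<le> real n" using elim(1) by auto
    then have n2: "1 / real n \<le> \<delta> / 2" and n3: "S / real n \<le> gap / 2"
      using N \<delta> gap by (simp_all add: field_simps)
    let ?a = "\<lambda>j s. nu_x L \<epsilon> \<alpha> n j (state n (X n) s) (state n (Y n) s) / (real n * arr L j)"
    have near: "near_fluid_class (arr L j) (srv L j) (\<alpha> j) (tilt L \<epsilon> \<alpha> j) T \<delta>
      (\<lambda>s. state n (X n) s j) (\<lambda>s. state n (Y n) s j) (?a j)" for j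
      using elim by (intro system_near_fluid_class[OF L e a _ n2 \<delta>(1,2) T]) (auto intro: eqs y0)
    have room: "(\<Sum>j\<in>UNIV. req L j * state n (X n) r j) + req L i / real n \<le> cap L"
      if r: "0 \<le> r" "r \<le> T" for r
    proof -
      have "req L j * state n (X n) r j \<le> req L j * ((1 + \<epsilon>) * (load L j * \<alpha> j) + 3 * \<delta>)" for j
        using near_fluid_class.fluid_upper[OF near r, of j] fluid_le[where \<alpha> = \<alpha> and i = j, OF L e a r(1)] b[of j]
        by (intro mult_left_mono) auto
      then have "(\<Sum>j\<in>UNIV. req L j * state n (X n) r j)
          \<le> (\<Sum>j\<in>UNIV. req L j * ((1 + \<epsilon>) * (load L j * \<alpha> j) + 3 * \<delta>))"
        by (intro sum_mono)
      also have "\<dots> = (1 + \<epsilon>) * (\<Sum>j\<in>UNIV. req L j * load L j * \<alpha> j) + 3 * \<delta> * S"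
        unfolding S_def sum_distrib_left sum.distrib[symmetric]
        by (intro sum.cong) (auto simp: algebra_simps)
      finally have "(\<Sum>j\<in>UNIV. req L j * state n (X n) r j) \<le> cap L - gap / 2"
        using slack gap_eq by linarith
      moreover have "req L i / real n \<le> S / real n"
        unfolding S_def using b by (intro divide_right_mono member_le_sum) (auto intro: less_imp_le)
      ultimately show ?thesis using n3 by linarith
    qed
    have acc: "?a i r = 1" if "0 \<le> r" "r \<le> T"
        "state n (X n) r i < \<alpha> i * (state n (X n) r i + state n (Y n) r i) + tilt L \<epsilon> \<alpha> i" for r
    proof -
      have "accepts L \<epsilon> \<alpha> n i (state n (X n) r) (state n (Y n) r)"
        using that by (intro accepts_below_threshold(2)[OF L e a] room) (auto simp: state_def)
      then show ?thesis using N L by (simp add: nu_x_def valid_model_def less_imp_neq[symmetric])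
    qed
    have "?fl i T \<le> state n (X n) T i + 3 * \<delta>" "state n (X n) T i \<le> ?fl i T + 3 * \<delta>"
      using near_fluid_class.fluid_lower[OF near[of i] acc T order_refl]
        near_fluid_class.fluid_upper[OF near[of i] T order_refl] by auto
    then show ?case using \<delta>(3) by (simp add: dist_real_def)
  qed
qed

lemma driving_processes_sublinear_error:
  fixes N :: "clock \<Rightarrow> ('i::finite) \<Rightarrow> real \<Rightarrow> 'w \<Rightarrow> nat"
  assumes "driving_processes M N"
  shows "AE \<omega> in M. \<forall>k i. sublinear_error (\<lambda>t. N k i t \<omega>)"
proof -
  have one: "AE \<omega> in M. sublinear_error (\<lambda>t. N k i t \<omega>)" for k i
    using assms by (intro poisson_process_sublinear_error) (auto simp: driving_processes_def)
  have "AE \<omega> in M. \<forall>i. sublinear_error (\<lambda>t. N k i t \<omega>)" for k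
  proof -
    have "AE \<omega> in M. \<forall>i\<in>UNIV. sublinear_error (\<lambda>t. N k i t \<omega>)"
      by (rule AE_finite_allI) (use one in auto)
    then show ?thesis by simp
  qed
  from this[of Ax] this[of Ay] this[of Dx] this[of Dy] show ?thesis
  proof eventually_elim
    case (elim \<omega>)
    show ?case
    proof
      fix k show "\<forall>i. sublinear_error (\<lambda>t. N k i t \<omega>)" using elim by (cases k) auto
    qed
  qed
qed

theorem theorem3:
  fixes L :: "('i::finite) loss_model"
    and \<alpha>s v :: "'i \<Rightarrow> real" and u :: real
  assumes "valid_model L"
    and "primal_optimal L \<alpha>s"
    and "\<And>i. \<alpha>s i > 0"
    and "dual_optimal L u v"
  shows "\<exists>C::real. \<forall>(\<epsilon>::real) (\<alpha>e :: 'i \<Rightarrow> real) (M :: 'w measure)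
            (N :: clock \<Rightarrow> 'i \<Rightarrow> real \<Rightarrow> 'w \<Rightarrow> nat)
            (y0 :: nat \<Rightarrow> 'i \<Rightarrow> nat)
            (X :: nat \<Rightarrow> 'i \<Rightarrow> real \<Rightarrow> 'w \<Rightarrow> nat) (Y :: nat \<Rightarrow> 'i \<Rightarrow> real \<Rightarrow> 'w \<Rightarrow> nat).
          0 < \<epsilon> \<longrightarrow> ereal \<epsilon> < min (eps0 L u v) (ereal (1/4)) \<longrightarrow>
          primal_optimal (shrunk \<epsilon> L) \<alpha>e \<longrightarrow>
          consistent_choice L \<alpha>s \<alpha>e \<longrightarrow>
          driving_processes M N \<longrightarrow>
          (\<forall>n\<ge>1. initial_load L \<alpha>e n (y0 n)) \<longrightarrow>
          (\<forall>n\<ge>1. penalty_system M N L \<epsilon> \<alpha>e n (y0 n) (X n) (Y n)) \<longrightarrow>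
          (\<exists>Rinf :: real \<Rightarrow> real. \<forall>t\<ge>0.
             (AE \<omega> in M. (\<lambda>n. reward_rate L n (X n) t \<omega>) \<longlonglongrightarrow> Rinf t) \<and>
             Rinf t \<ge> transient_reward L \<alpha>s t - C * \<epsilon>)"
proof (intro exI allI impI)
  fix \<epsilon> :: real and \<alpha>e :: "'i \<Rightarrow> real" and M :: "'w measure"
    and N :: "clock \<Rightarrow> 'i \<Rightarrow> real \<Rightarrow> 'w \<Rightarrow> nat" and y0 :: "nat \<Rightarrow> 'i \<Rightarrow> nat"
    and X Y :: "nat \<Rightarrow> 'i \<Rightarrow> real \<Rightarrow> 'w \<Rightarrow> nat" and t :: real
  let ?R = "\<lambda>t. \<Sum>i\<in>UNIV. rew L i * fluid (arr L i) (srv L i) (\<alpha>e i) (tilt L \<epsilon> \<alpha>e i) t"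
  assume e0: "0 < \<epsilon>" and "ereal \<epsilon> < min (eps0 L u v) (ereal (1/4))"
    and opt: "primal_optimal (shrunk \<epsilon> L) \<alpha>e" and cc: "consistent_choice L \<alpha>s \<alpha>e"
    and dp: "driving_processes M N" and y0: "\<forall>n\<ge>1. initial_load L \<alpha>e n (y0 n)"
    and sys: "\<forall>n\<ge>1. penalty_system M N L \<epsilon> \<alpha>e n (y0 n) (X n) (Y n)"
    and t: "0 \<le> t"
  then have e: "0 < \<epsilon>" "\<epsilon> < 1/4" by auto
  have f: "primal_feasible (shrunk \<epsilon> L) \<alpha>e" using opt by (simp add: primal_optimal_def)
  then have a: "0 \<le> \<alpha>e i" "\<alpha>e i \<le> 1" for i by (auto simp: primal_feasible_def)
  have "AE \<omega> in M. \<forall>n. 1 \<le> n \<longrightarrow>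
      time_change_equations (\<lambda>k i t. N k i t \<omega>) L \<epsilon> \<alpha>e n (y0 n) (\<lambda>i t. X n i t \<omega>) (\<lambda>i t. Y n i t \<omega>)"
    unfolding AE_all_countable
    using sys by (auto simp: penalty_system_def time_change_equations_def normalized_def state_def)
  with driving_processes_sublinear_error[OF dp]
  have "AE \<omega> in M. (\<lambda>n. reward_rate L n (X n) t \<omega>) \<longlonglongrightarrow> ?R t"
  proof eventually_elim
    case (elim \<omega>)
    have "(\<lambda>n. state n (\<lambda>i t. X n i t \<omega>) t i) \<longlonglongrightarrow> fluid (arr L i) (srv L i) (\<alpha>e i) (tilt L \<epsilon> \<alpha>e i) t" for i
      using elim y0 by (intro fluid_limit[OF assms(1) e f _ _ _ t, where P = "\<lambda>k i t. N k i t \<omega>"]) auto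
    then have "(\<lambda>n. \<Sum>i\<in>UNIV. rew L i * state n (\<lambda>i t. X n i t \<omega>) t i) \<longlonglongrightarrow> ?R t"
      by (intro tendsto_sum tendsto_mult tendsto_const)
    then show ?case by (simp add: reward_rate_def scaled_def state_def)
  qed
  \<comment> \<open>The first part of the constant pays for the shift \<open>tilt\<close> of the thresholds, the second for the shrunk capacity.\<close>
  moreover have "transient_reward L \<alpha>s t - ((\<Sum>i\<in>UNIV. rew L i * load L i) + 4 * primal_value L \<alpha>s) * \<epsilon> \<le> ?R t"
  proof -
    have r: "0 \<le> rew L i" for i using assms(1) by (simp add: valid_model_def)
    have "transient_reward L \<alpha>e t - \<epsilon> * (\<Sum>i\<in>UNIV. rew L i * load L i)
        = (\<Sum>i\<in>UNIV. rew L i * (load L i * \<alpha>e i * (1 - exp (- srv L i * t)) - \<epsilon> * load L i))"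
      unfolding transient_reward_def sum_distrib_left sum_subtractf[symmetric]
      by (intro sum.cong) (auto simp: algebra_simps)
    also have "\<dots> \<le> ?R t"
      using r fluid_ge[OF assms(1) e a t] by (intro sum_mono mult_left_mono)
    finally show ?thesis
      using transient_reward_shrunk[OF assms(1,2) _ opt cc t] e by (simp add: algebra_simps)
  qed
  ultimately show "(AE \<omega> in M. (\<lambda>n. reward_rate L n (X n) t \<omega>) \<longlonglongrightarrow> ?R t) \<and>
      transient_reward L \<alpha>s t - ((\<Sum>i\<in>UNIV. rew L i * load L i) + 4 * primal_value L \<alpha>s) * \<epsilon> \<le> ?R t"
    by blast
qed

end
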